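(* Let $\theta=[a_1,a_2,\dots]$ be irrational with $a_1=a_2=a_3=1$. There exists a $\theta$-recurrent unimodal map $f$ with critical orbit $\mathcal O=\{x_k=f^k(0)\}_{k\ge0}$ such that the map $k\mapsto x_k$ (finite Ostrowski words identified with nonnegative integers) extends to a homeomorphism $\varkappa\mapsto x_\varkappa$ from the space $W$ of all finite or infinite Ostrowski words (with the product topology) onto $\overline{\mathcal O}$, and this encoding satisfies $x_{1+\varkappa}=f(x_\varkappa)$ for all $\varkappa\in W$, where $\varkappa\mapsto1+\varkappa$ denotes the continuous extension to $W$ of the map $k\mapsto k+1$ on finite words.
   Context: Let $I=[-1,1]$. A unimodal map is a continuous $f:I\to I$ strictly decreasing on $[-1,0]$, strictly increasing on $[0,1]$, $f(\pm1)=1$. For $x\neq0$ let $x'$ be the other point with $f(x')=f(x)$, $0':=0$, $I_x$ the closed interval with endpoints $x,x'$. $\theta=[a_1,a_2,\dots]=1/(a_1+1/(a_2+\cdots))$, $q_n$ the denominator of $[a_1,\dots,a_n]$. For $x\in I$ with orbit $x_k=f^k(x)$, $k\ge1$ is a time of closest recurrence of $x$ to $I_x$ if $f(x_k)<f(x_j)$ for all $0<j<k$. For $\theta_N=[a_1,\dots,a_N]$, $x$ has $\theta_N$-recurrence if: (i) $x_k\notin I_x$ for $k=1,\dots,q_N$; (ii) the times of closest recurrence of $x$ to $I_x$ in $\{1,\dots,q_N\}$ are exactly $q_1,\dots,q_N$; (iii) for $m=0,\dots,a_N-1$, $x_{mq_{N-1}}$ has $[a_1,\dots,a_{N-1}]$-recurrence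 (void for $N=1$). $f$ is $\theta$-recurrent if $0$ has $[a_1,\dots,a_n]$-recurrence for every $n$. Ostrowski words: digit sequences $(\gamma_1\gamma_2\cdots)$ with integers $0\le\gamma_n\le a_{n+1}$ and $\gamma_n=a_{n+1}\Rightarrow\gamma_{n-1}=0$; a word with finitely many nonzero digits is identified with the integer $\sum\gamma_nq_n$ (every nonnegative integer arises uniquely); $W$ is the set of all such words, finite or infinite, with the product topology (infinite words are limits of their finite truncations). *)

theory Defs
  imports "HOL-Analysis.Analysis"
begin

text \<open>Continued fraction denominators q_n of [a_1,...,a_n]; a is indexed from 1
  (a 0 is unused). q 0 = 1, q 1 = a 1, q (n+2) = a (n+2) * q (n+1) + q n.\<close>
fun cf_den :: "(nat \<Rightarrow> nat) \<Rightarrow> nat \<Rightarrow> nat" where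
  "cf_den a 0 = 1"
| "cf_den a (Suc 0) = a 1"
| "cf_den a (Suc (Suc n)) = a (Suc (Suc n)) * cf_den a (Suc n) + cf_den a n"

definition unimodal :: "(real \<Rightarrow> real) \<Rightarrow> bool" where
  "unimodal f \<longleftrightarrow> continuous_on {-1..1} f \<and> f ` {-1..1} \<subseteq> {-1..1}
     \<and> (\<forall>x y. -1 \<le> x \<and> x < y \<and> y \<le> 0 \<longrightarrow> f y < f x)
     \<and> (\<forall>x y. 0 \<le> x \<and> x < y \<and> y \<le> 1 \<longrightarrow> f x < f y)
     \<and> f (-1) = 1 \<and> f 1 = 1"

definition twin :: "(real \<Rightarrow> real) \<Rightarrow> real \<Rightarrow> real" where
  "twin f x = (if x = 0 then 0 else (THE y. y \<in> {-1..1} \<and> y \<noteq> x \<and> f y = f x))"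

definition Ix :: "(real \<Rightarrow> real) \<Rightarrow> real \<Rightarrow> real set" where
  "Ix f x = {min x (twin f x) .. max x (twin f x)}"

definition closest_time :: "(real \<Rightarrow> real) \<Rightarrow> real \<Rightarrow> nat \<Rightarrow> bool" where
  "closest_time f x k \<longleftrightarrow> 1 \<le> k \<and>
     (\<forall>j. 0 < j \<and> j < k \<longrightarrow> f ((f ^^ k) x) < f ((f ^^ j) x))"

text \<open>theta_rec a f N x : x has [a_1,...,a_N]-recurrence (meaningful for N \<ge> 1).\<close>
fun theta_rec :: "(nat \<Rightarrow> nat) \<Rightarrow> (real \<Rightarrow> real) \<Rightarrow> nat \<Rightarrow> real \<Rightarrow> bool" where
  "theta_rec a f 0 x = True"
| "theta_rec a f (Suc n) x \<longleftrightarrow>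
     (\<forall>k\<in>{1..cf_den a (Suc n)}. (f ^^ k) x \<notin> Ix f x)
   \<and> {k \<in> {1..cf_den a (Suc n)}. closest_time f x k} = cf_den a ` {1..Suc n}
   \<and> (1 \<le> n \<longrightarrow> (\<forall>m < a (Suc n). theta_rec a f n ((f ^^ (m * cf_den a n)) x)))"

definition theta_recurrent :: "(nat \<Rightarrow> nat) \<Rightarrow> (real \<Rightarrow> real) \<Rightarrow> bool" where
  "theta_recurrent a f \<longleftrightarrow> (\<forall>n\<ge>1. theta_rec a f n 0)"

text \<open>Ostrowski words: digit sequences gamma_1 gamma_2 ... stored as nat \<Rightarrow> nat with
  the unused index 0 set to 0; product topology on nat \<Rightarrow> nat (nat discrete).\<close>
definition ostrowski_words :: "(nat \<Rightarrow> nat) \<Rightarrow> (nat \<Rightarrow> nat) set" where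
  "ostrowski_words a = {g. g 0 = 0 \<and> (\<forall>n\<ge>1. g n \<le> a (Suc n))
      \<and> (\<forall>n\<ge>2. g n = a (Suc n) \<longrightarrow> g (n - 1) = 0)}"

definition finite_ostrowski_words :: "(nat \<Rightarrow> nat) \<Rightarrow> (nat \<Rightarrow> nat) set" where
  "finite_ostrowski_words a = {g \<in> ostrowski_words a. finite {n. g n \<noteq> 0}}"

definition ostrowski_val :: "(nat \<Rightarrow> nat) \<Rightarrow> (nat \<Rightarrow> nat) \<Rightarrow> nat" where
  "ostrowski_val a g = (\<Sum>n\<in>{n. g n \<noteq> 0}. g n * cf_den a n)"

end

theory Submission
  imports Defs
begin

text \<open>
  The points of the critical orbit closure are placed explicitly on the line. A word
  \<open>g\<close> with digits \<open>g n\<close> goes to the series \<open>pt g\<close> of \<open>\<plusminus>g n * weight n\<close>, where the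
  weights decrease so fast that two words are compared by their first differing digit alone.
  The signs are forced by the wish that \<open>g \<mapsto> 1 + g\<close> become a unimodal map with turning point
  \<open>0\<close>: every nonzero digit reverses the orientation of what follows it, the return point
  \<open>x\<^bsub>q n\<^esub>\<close> lies on the side \<open>- orient n\<close>, its multiples \<open>x\<^bsub>m * q n\<^esub>\<close> with \<open>m \<ge> 2\<close> lie
  on the opposite side, and \<open>orient (n + 2) = - orient n\<close>, giving the period four pattern
  \<open>- + + -\<close> known from the Fibonacci map. Following the carry in \<open>1 + g\<close> shows that adding
  one preserves the order on the positive words, reverses it on the negative ones and has its
  minimum at \<open>0\<close>, so it extends to a unimodal map by linear interpolation in the gaps. The
  recurrence conditions then are comparisons of leading digits.
\<close>

subsection \<open>Monotone extension and unimodal maps\<close>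

text \<open>A monotone map of the line that is onto is continuous, so it suffices to interpolate
  linearly in the gaps of \<open>K\<close> and to prove surjectivity. The last four hypotheses give
  every point neighbours in \<open>K\<close> on both sides and bracket every value by values of
  \<open>g\<close>.\<close>

lemma strict_mono_on_closed_extension:
  fixes g :: "real \<Rightarrow> real"
  assumes clo: "closed K" and cont: "continuous_on K g" and mono: "strict_mono_on K g"
    and below: "\<And>x. \<exists>k\<in>K. k \<le> x" and above: "\<And>x. \<exists>k\<in>K. x \<le> k"
    and gbelow: "\<And>y. \<exists>k\<in>K. g k \<le> y" and gabove: "\<And>y. \<exists>k\<in>K. y \<le> g k"
  obtains F where "strict_mono F" "continuous_on UNIV F" "\<And>x. x \<in> K \<Longrightarrow> F x = g x"
proof -
  have mono_le: "x \<le> y \<longleftrightarrow> g x \<le> g y" if "x \<in> K" "y \<in> K" for x y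
    using mono that by (metis linorder_not_less order_le_less strict_mono_onD)
  have mono_less: "x < y \<longleftrightarrow> g x < g y" if "x \<in> K" "y \<in> K" for x y
    using mono_le[of y x] that by auto
  have "\<exists>l\<in>K. l \<le> x \<and> (\<forall>k\<in>K. k \<le> x \<longrightarrow> k \<le> l)" for x
  proof -
    let ?P = "K \<inter> {..x}"
    have "Sup ?P \<in> ?P"
      using below[of x] clo by (intro closed_contains_Sup) (auto intro!: bdd_aboveI[of _ x])
    moreover have "k \<le> Sup ?P" if "k \<in> ?P" for k
      using that by (intro cSup_upper) (auto intro!: bdd_aboveI[of _ x])
    ultimately show ?thesis by auto
  qed
  then obtain l where l: "\<And>x. l x \<in> K" "\<And>x. l x \<le> x" "\<And>x k. k \<in> K \<Longrightarrow> k \<le> x \<Longrightarrow> k \<le> l x"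
    by metis
  have "\<exists>r\<in>K. x \<le> r \<and> (\<forall>k\<in>K. x \<le> k \<longrightarrow> r \<le> k)" for x
  proof -
    let ?P = "K \<inter> {x..}"
    have "Inf ?P \<in> ?P"
      using above[of x] clo by (intro closed_contains_Inf) (auto intro!: bdd_belowI[of _ x])
    moreover have "Inf ?P \<le> k" if "k \<in> ?P" for k
      using that by (intro cInf_lower) (auto intro!: bdd_belowI[of _ x])
    ultimately show ?thesis by auto
  qed
  then obtain r where r: "\<And>x. r x \<in> K" "\<And>x. x \<le> r x" "\<And>x k. k \<in> K \<Longrightarrow> x \<le> k \<Longrightarrow> r x \<le> k"
    by metis
  \<comment> \<open>On \<open>K\<close> the numerator \<open>x - l x\<close> is zero, so the formula
    returns \<open>g x\<close> there without a case distinction.\<close>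
  define F where "F x = g (l x) + (x - l x) / (r x - l x) * (g (r x) - g (l x))" for x
  have FK: "F x = g x" if "x \<in> K" for x
    using l(2)[of x] l(3)[of x x] that by (simp add: F_def)
  have gap: "l x < x" "x < r x" "g (l x) < F x" "F x < g (r x)" if "x \<notin> K" for x
  proof -
    show lr: "l x < x" "x < r x"
      using l(1,2)[of x] r(1,2)[of x] that by (metis order_le_less)+
    then have "g (l x) < g (r x)"
      using mono_less[OF l(1) r(1), of x x] by linarith
    moreover have "0 < (x - l x) / (r x - l x)" "(x - l x) / (r x - l x) < 1"
      using lr by (auto simp: field_simps)
    ultimately have "0 < (x - l x) / (r x - l x) * (g (r x) - g (l x))"
      and "(x - l x) / (r x - l x) * (g (r x) - g (l x)) < 1 * (g (r x) - g (l x))"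
      by (intro mult_pos_pos mult_strict_right_mono; simp)+
    then show "g (l x) < F x" "F x < g (r x)"
      by (auto simp: F_def)
  qed
  have less_K: "F x < g z" if "x < z" "z \<in> K" for x z
  proof (cases "x \<in> K")
    case True
    then show ?thesis using that FK mono_less by auto
  next
    case False
    then show ?thesis
      using gap(4)[OF False] mono_le[OF r(1) that(2), of x] r(3)[OF that(2), of x] that(1) by linarith
  qed
  have K_less: "g z < F x" if "z < x" "z \<in> K" for x z
  proof (cases "x \<in> K")
    case True
    then show ?thesis using that FK mono_less by auto
  next
    case False
    then show ?thesis
      using gap(3)[OF False] mono_le[OF that(2) l(1), of x] l(3)[OF that(2), of x] that(1) by linarith
  qed
  have sm: "strict_mono F"
  proof (rule strict_monoI)
    fix x y :: real assume xy: "x < y"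
    show "F x < F y"
    proof (cases "\<exists>z\<in>K. x \<le> z \<and> z \<le> y")
      case True
      then obtain z where z: "z \<in> K" "x \<le> z" "z \<le> y" by auto
      show ?thesis
      proof (cases "x = z")
        case True
        then show ?thesis using K_less[of z y] z xy FK by auto
      next
        case False
        then have "F x < g z" using less_K z by auto
        also have "g z \<le> F y" using K_less[of z y] z FK by (cases "z = y") auto
        finally show ?thesis .
      qed
    next
      case False
      \<comment> \<open>No point of \<open>K\<close> separates \<open>x\<close> from
        \<open>y\<close>: both lie in one gap, where \<open>F\<close> is affine.\<close>
      then have "x \<notin> K" using xy by auto
      have "l y < x" using False l(1,2)[of y] by (meson not_le)
      then have leq: "l x = l y"
        using l(3)[OF l(1), of y x] l(3)[OF l(1), of x y] l(2)[of x] xy by linarith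
      have "y < r x" using False r(1,2)[of x] by (meson not_le)
      then have req: "r x = r y"
        using r(3)[OF r(1), of x y] r(3)[OF r(1), of y x] r(2)[of y] xy by linarith
      have "(x - l x) / (r x - l x) < (y - l x) / (r x - l x)"
        using gap[OF \<open>x \<notin> K\<close>] xy by (intro divide_strict_right_mono) auto
      then have "(x - l x) / (r x - l x) * (g (r x) - g (l x)) < (y - l x) / (r x - l x) * (g (r x) - g (l x))"
        using gap[OF \<open>x \<notin> K\<close>] by (intro mult_strict_right_mono) auto
      then show ?thesis unfolding F_def leq req by simp
    qed
  qed
  have "\<exists>x. F x = w" for w
  proof -
    let ?P = "K \<inter> g -` {..w}" and ?Q = "K \<inter> g -` {w..}"
    obtain k1 k2 where k: "k1 \<in> K" "g k1 \<le> w" "k2 \<in> K" "w \<le> g k2"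
      using gbelow gabove by metis
    have b: "x \<le> k2" if "x \<in> ?P" for x
      using that mono_le[of x k2] k by auto
    have c: "k1 \<le> x" if "x \<in> ?Q" for x
      using that mono_le[of k1 x] k by auto
    have bP: "bdd_above ?P" using b by (rule bdd_aboveI)
    have bQ: "bdd_below ?Q" using c by (rule bdd_belowI)
    have "closed ?P" "closed ?Q"
      using continuous_closed_preimage[OF cont clo] by auto
    moreover have "?P \<noteq> {}" "?Q \<noteq> {}" using k by auto
    ultimately have p: "Sup ?P \<in> ?P" and q: "Inf ?Q \<in> ?Q"
      using bP bQ by (metis closed_contains_Sup, metis closed_contains_Inf)
    \<comment> \<open>The last point of \<open>K\<close> with value at most \<open>w\<close> and the
      first with value at least \<open>w\<close>. If neither attains \<open>w\<close>, they bound a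
      gap of \<open>K\<close>, and the affine piece over it takes the value
      \<open>w\<close>.\<close>
    define p q where "p = Sup ?P" and "q = Inf ?Q"
    have pK: "p \<in> K" "g p \<le> w" and qK: "q \<in> K" "w \<le> g q"
      using p q by (auto simp: p_def q_def)
    have ple: "x \<le> p" if "x \<in> K" "g x \<le> w" for x
      unfolding p_def using that bP by (auto intro!: cSup_upper)
    have qle: "q \<le> x" if "x \<in> K" "w \<le> g x" for x
      unfolding q_def using that bQ by (auto intro!: cInf_lower)
    show ?thesis
    proof (cases "g p = w \<or> g q = w")
      case True
      then show ?thesis using FK pK qK by metis
    next
      case False
      then have w: "g p < w" "w < g q" using pK qK by auto
      then have pq: "p < q" using mono_less pK qK by auto
      define u where "u = (w - g p) / (g q - g p)"
      have u: "0 < u" "u < 1" using w by (auto simp: u_def)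
      define x where "x = p + u * (q - p)"
      have "p < x" unfolding x_def using u pq by simp
      moreover have "u * (q - p) < 1 * (q - p)" using u pq by (intro mult_strict_right_mono) auto
      then have "x < q" unfolding x_def by (simp only: less_diff_eq mult_1_left add.commute)
      ultimately have x: "p < x" "x < q" by auto
      have *: "k \<le> p \<or> q \<le> k" if "k \<in> K" for k using ple qle that by force
      have "l x = p" using *[OF l(1), of x] l(2)[of x] l(3)[OF pK(1), of x] x by linarith
      moreover have "r x = q" using *[OF r(1), of x] r(2)[of x] r(3)[OF qK(1), of x] x by linarith
      ultimately have "F x = g p + u * (g q - g p)"
        using pq by (simp add: F_def x_def)
      then show ?thesis using w by (auto simp: u_def)
    qed
  qed
  then have "F ` UNIV = UNIV" by (metis surj_def)
  then have "continuous_on UNIV F"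
    using sm by (intro continuous_onI_mono) (auto simp: strict_mono_less_eq)
  then show ?thesis using that sm FK by blast
qed

section \<open>Twins and the intervals \<open>Ix\<close>\<close>

lemma unimodal_halves_inj:
  assumes "unimodal f" "x \<in> {-1..1}" "y \<in> {-1..1}" "f x = f y" "0 \<le> x * y"
  shows "x = y"
proof (rule ccontr)
  assume "x \<noteq> y"
  have dec: "f v < f u" if "-1 \<le> u" "u < v" "v \<le> 0" for u v
    using assms(1) that by (auto simp: unimodal_def)
  have inc: "f u < f v" if "0 \<le> u" "u < v" "v \<le> 1" for u v
    using assms(1) that by (auto simp: unimodal_def)
  have "x \<le> 0 \<and> y \<le> 0 \<or> 0 \<le> x \<and> 0 \<le> y" using assms(5) by (auto simp: zero_le_mult_iff)
  then show False
    using dec[of x y] dec[of y x] inc[of x y] inc[of y x] assms(2-4) \<open>x \<noteq> y\<close>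
    by (cases "x < y") auto
qed

text \<open>The intermediate value theorem supplies a partner on the other side of \<open>0\<close>,
  and injectivity on each half makes it the only one; this evaluates the definite description in
  \<open>twin\<close>.\<close>

lemma unimodal_twin:
  assumes uni: "unimodal f" and x: "x \<noteq> 0" "-1 < x" "x < 1"
  shows "twin f x \<in> {-1..1}" "f (twin f x) = f x" "x * twin f x \<le> 0"
proof -
  have cont: "continuous_on {-1..1} f" and ends: "f (-1) = 1" "f 1 = 1"
    using uni by (auto simp: unimodal_def)
  have fx: "f 0 < f x" "f x < 1"
    using uni x ends unfolding unimodal_def by (metis less_eq_real_def linorder_neqE_linordered_idom)+
  have ex: "\<exists>y. y \<in> {-1..1} \<and> x * y \<le> 0 \<and> f y = f x"
  proof (cases "x > 0")
    case True
    obtain y where "-1 \<le> y" "y \<le> 0" "f y = f x"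
      using IVT2'[of f 0 "f x" "-1"] fx ends continuous_on_subset[OF cont, of "{-1..0}"] by force
    then show ?thesis using True by (intro exI[of _ y]) (auto simp: mult_le_0_iff)
  next
    case False
    obtain y where "0 \<le> y" "y \<le> 1" "f y = f x"
      using IVT'[of f 0 "f x" 1] fx ends continuous_on_subset[OF cont, of "{0..1}"] by force
    then show ?thesis using False by (intro exI[of _ y]) (auto simp: mult_le_0_iff)
  qed
  have neg: "x * y < 0" if "y \<in> {-1..1}" "y \<noteq> x" "f y = f x" for y
  proof (rule ccontr)
    assume "\<not> x * y < 0"
    then show False using unimodal_halves_inj[OF uni, of x y] that x by auto
  qed
  obtain y where y: "y \<in> {-1..1}" "x * y \<le> 0" "f y = f x" using ex by blast
  have "y \<noteq> x" using y(2) x(1) by (auto simp: mult_le_0_iff)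
  have "twin f x = y"
    unfolding twin_def using x(1)
  proof (simp, intro the_equality)
    show "- 1 \<le> y \<and> y \<le> 1 \<and> y \<noteq> x \<and> f y = f x" using y \<open>y \<noteq> x\<close> by auto
    fix z assume "- 1 \<le> z \<and> z \<le> 1 \<and> z \<noteq> x \<and> f z = f x"
    then show "z = y"
      using neg[of z] neg[of y] y \<open>y \<noteq> x\<close> unimodal_halves_inj[OF uni, of z y]
      by (auto simp: mult_less_0_iff zero_le_mult_iff)
  qed
  then show "twin f x \<in> {-1..1}" "f (twin f x) = f x" "x * twin f x \<le> 0" using y by auto
qed

text \<open>The interval straddles \<open>0\<close>, so \<open>f\<close> is bounded on it by its
  common value at the two ends. Condition (i) of recurrence thus becomes a comparison of
  images.\<close>

lemma unimodal_not_in_Ix: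
  assumes uni: "unimodal f" and x: "-1 < x" "x < 1" and less: "f x < f z"
  shows "z \<notin> Ix f x"
proof
  assume z: "z \<in> Ix f x"
  show False
  proof (cases "x = 0")
    case True
    then show ?thesis using z less by (simp add: Ix_def twin_def)
  next
    case False
    note t = unimodal_twin[OF uni False x]
    define l r where "l = min x (twin f x)" and "r = max x (twin f x)"
    have lr: "-1 \<le> l" "l \<le> 0" "0 \<le> r" "r \<le> 1" "f l = f x" "f r = f x"
      using t x by (auto simp: l_def r_def min_def max_def mult_le_0_iff)
    have "l \<le> z" "z \<le> r" using z by (auto simp: Ix_def l_def r_def)
    then have "f z \<le> f x"
      using uni lr unfolding unimodal_def by (metis order_le_less linorder_le_cases)
    then show ?thesis using less by simp
  qed
qed

section \<open>Cylinder sets in the word space\<close>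

lemma closed_digit: "closed {g :: nat \<Rightarrow> nat. P (g n)}"
proof -
  have "closed ((\<lambda>g :: nat \<Rightarrow> nat. g n) -` {m. P m})"
    by (intro closed_vimage continuous_on_product_coordinates) (simp add: closed_def open_discrete)
  then show ?thesis by (simp add: vimage_def)
qed

lemma eventually_agree:
  fixes g :: "nat \<Rightarrow> nat"
  shows "\<forall>\<^sub>F h in at g within A. \<forall>j\<le>i. h j = g j"
proof -
  have "open {h. h j = g j}" for j :: nat
    using closed_digit[of "\<lambda>m. m \<noteq> g j" j] by (simp add: closed_def Compl_eq)
  then have "open (\<Inter>j\<in>{..i}. {h. h j = g j})" by (intro open_INT) auto
  then have "\<forall>\<^sub>F h in nhds g. h \<in> (\<Inter>j\<in>{..i}. {h. h j = g j})"
    by (rule eventually_nhds_in_open) auto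
  then have "\<forall>\<^sub>F h in nhds g. \<forall>j\<le>i. h j = g j" by eventually_elim auto
  then show ?thesis by (simp add: eventually_at_filter eventually_mono)
qed

subsection \<open>Ostrowski words and the successor\<close>

lemma first_difference:
  fixes g h :: "nat \<Rightarrow> nat"
  assumes "g \<noteq> h"
  obtains i where "\<And>j. j < i \<Longrightarrow> g j = h j" "g i \<noteq> h i"
proof
  have "\<exists>i. g i \<noteq> h i" using assms by auto
  then show "g (LEAST i. g i \<noteq> h i) \<noteq> h (LEAST i. g i \<noteq> h i)" by (rule LeastI_ex)
qed (use not_less_Least in blast)

locale ostrowski =
  fixes a :: "nat \<Rightarrow> nat"
  assumes pos: "\<And>n. n \<ge> 1 \<Longrightarrow> a n \<ge> 1"
    and a1: "a (Suc 0) = 1" and a2: "a (Suc (Suc 0)) = 1" and a3: "a (Suc (Suc (Suc 0))) = 1"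
begin

abbreviation "q \<equiv> cf_den a"
abbreviation "W \<equiv> ostrowski_words a"
abbreviation "FW \<equiv> finite_ostrowski_words a"
abbreviation "val \<equiv> ostrowski_val a"

lemma a_pos [simp]: "0 < a (Suc n)"
  using pos[of "Suc n"] by simp

lemma a_nonzero [simp]: "a (Suc n) \<noteq> 0"
  using a_pos[of n] by simp

lemma W_iff: "g \<in> W \<longleftrightarrow> g 0 = 0 \<and>
    (\<forall>n. g n \<le> a (Suc n) \<and> (g (Suc n) = a (Suc (Suc n)) \<longrightarrow> g n = 0))"
proof
  assume g: "g \<in> W"
  have "g n \<le> a (Suc n)" for n
    using g by (cases n) (auto simp: ostrowski_words_def)
  moreover have "g n = 0" if "g (Suc n) = a (Suc (Suc n))" for n
  proof (cases n)
    case 0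
    then show ?thesis using g by (simp add: ostrowski_words_def)
  next
    case (Suc m)
    have "\<forall>n\<ge>2. g n = a (Suc n) \<longrightarrow> g (n - 1) = 0"
      using g unfolding ostrowski_words_def by blast
    from this[rule_format, of "Suc n"] show ?thesis using Suc that by simp
  qed
  ultimately show "g 0 = 0 \<and> (\<forall>n. g n \<le> a (Suc n) \<and> (g (Suc n) = a (Suc (Suc n)) \<longrightarrow> g n = 0))"
    using g by (simp add: ostrowski_words_def)
next
  assume g: "g 0 = 0 \<and> (\<forall>n. g n \<le> a (Suc n) \<and> (g (Suc n) = a (Suc (Suc n)) \<longrightarrow> g n = 0))"
  have "g (n - 1) = 0" if "n \<ge> 2" "g n = a (Suc n)" for n
    using g that by (cases n) auto
  then show "g \<in> W"
    using g by (simp add: ostrowski_words_def)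
qed

lemma W_0: "g \<in> W \<Longrightarrow> g 0 = 0"
  and W_le: "g \<in> W \<Longrightarrow> g n \<le> a (Suc n)"
  and W_prev: "g \<in> W \<Longrightarrow> g (Suc n) = a (Suc (Suc n)) \<Longrightarrow> g n = 0"
  by (auto simp: W_iff)

lemma zero_W: "(\<lambda>_. 0) \<in> W"
  by (auto simp: W_iff)

section \<open>Denominators and values of finite words\<close>

lemma q_pos: "0 < q n"
  by (induction n rule: induct_nat_012) (simp_all add: a1)

lemma q_mono: "q n \<le> q (Suc n)"
proof (cases n)
  case 0
  then show ?thesis by (simp add: a1)
next
  case (Suc m)
  have "q (Suc m) \<le> a (Suc (Suc m)) * q (Suc m)" by (simp add: Suc_le_eq)
  then show ?thesis using Suc by (metis cf_den.simps(3) le_add1 le_trans)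
qed

lemma q_le: "m \<le> n \<Longrightarrow> q m \<le> q n"
  using q_mono by (rule lift_Suc_mono_le)

text \<open>If digit \<open>n - 1\<close> is maximal, the digit before it is zero, and the bound at
  \<open>n - 2\<close> fits the recursion for \<open>q n\<close>. Otherwise one copy of
  \<open>q (n - 1)\<close> is spare and covers all lower digits.\<close>

lemma prefix_less: "g \<in> W \<Longrightarrow> (\<Sum>j<n. g j * q j) < q n"
proof (induction n rule: less_induct)
  case (less n)
  consider "n = 0" | "n = 1" | m where "n = Suc (Suc m)"
    by (metis One_nat_def not0_implies_Suc)
  then show ?case
  proof cases
    case 3
    show ?thesis
    proof (cases "g (Suc m) = a (Suc (Suc m))")
      case True
      then have "g m = 0" using W_prev less.prems by blast
      then show ?thesis using less.IH[of m] less.prems 3 True by simp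
    next
      case False
      then have "Suc (g (Suc m)) \<le> a (Suc (Suc m))"
        using W_le[OF less.prems, of "Suc m"] by simp
      then have "Suc (g (Suc m)) * q (Suc m) \<le> a (Suc (Suc m)) * q (Suc m)"
        by (rule mult_right_mono) simp
      moreover have "(\<Sum>j<Suc m. g j * q j) < q (Suc m)"
        using less.IH[of "Suc m"] less.prems 3 by simp
      ultimately show ?thesis using 3 by (simp add: algebra_simps)
    qed
  qed (use less.prems in \<open>auto simp: W_0 a1\<close>)
qed

lemma val_eq:
  assumes "\<And>n. n \<ge> M \<Longrightarrow> g n = 0"
  shows "val g = (\<Sum>n<M. g n * q n)"
proof -
  have "n < M" if "g n \<noteq> 0" for n
    using assms[of n] that by linarith
  then have "{n. g n \<noteq> 0} \<subseteq> {..<M}" by auto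
  then show ?thesis unfolding ostrowski_val_def by (intro sum.mono_neutral_left) auto
qed

lemma FW_iff: "g \<in> FW \<longleftrightarrow> g \<in> W \<and> (\<exists>M. \<forall>n\<ge>M. g n = 0)"
proof -
  have "finite {n. g n \<noteq> 0} \<longleftrightarrow> (\<exists>M. \<forall>n\<ge>M. g n = 0)"
    unfolding finite_nat_set_iff_bounded by (metis (mono_tags, lifting) mem_Collect_eq not_le)
  then show ?thesis by (simp add: finite_ostrowski_words_def)
qed

text \<open>By \<open>prefix_less\<close> the lower digits cannot make up for a difference in the
  top digit, so the digits are recovered from the top downwards.\<close>

lemma val_inj:
  assumes g: "g \<in> FW" and h: "h \<in> FW" and eq: "val g = val h"
  shows "g = h"
proof (rule ccontr)
  assume "g \<noteq> h"
  obtain M1 M2 where M12: "\<forall>n\<ge>M1. g n = 0" "\<forall>n\<ge>M2. h n = 0"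
    using g h unfolding FW_iff by blast
  define M where "M = max M1 M2"
  have M: "g n = 0" "h n = 0" if "n \<ge> M" for n
    using M12 that by (auto simp: M_def)
  have eqM: "(\<Sum>n<M. g n * q n) = (\<Sum>n<M. h n * q n)"
    using val_eq[of M g] val_eq[of M h] M eq by simp
  have W: "g \<in> W" "h \<in> W" using g h by (auto simp: FW_iff)
  have aux: "g n = h n" if "(\<Sum>j<Suc n. g j * q j) = (\<Sum>j<Suc n. h j * q j)" for n
  proof -
    have "\<not> u n < v n" if "(\<Sum>j<Suc n. u j * q j) = (\<Sum>j<Suc n. v j * q j)" "u \<in> W" for u v
    proof
      assume "u n < v n"
      then have "Suc (u n) * q n \<le> v n * q n" by (intro mult_right_mono) auto
      then show False using that prefix_less[of u n] by simp
    qed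
    from this[of g h] this[of h g] show ?thesis using that W by simp
  qed
  have "\<forall>n<k. g n = h n" if "(\<Sum>n<k. g n * q n) = (\<Sum>n<k. h n * q n)" for k
    using that
  proof (induction k)
    case (Suc k)
    have "g k = h k" using aux Suc.prems by blast
    then show ?case using Suc by (simp add: less_Suc_eq)
  qed simp
  then have "g n = h n" for n using eqM M by (cases "n < M") auto
  then show False using \<open>g \<noteq> h\<close> by auto
qed

text \<open>
  \<open>carry g n\<close> says that the digits of \<open>g\<close> below \<open>n\<close> form the maximal word, of value
  \<open>q n - 1\<close>. The carries occur in steps of two because \<open>a (n + 2) * q (n + 1) + q n = q (n + 2)\<close>.
\<close>

fun carry :: "(nat \<Rightarrow> nat) \<Rightarrow> nat \<Rightarrow> bool" where
  "carry g 0 = True"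
| "carry g (Suc 0) = True"
| "carry g (Suc (Suc n)) = (carry g n \<and> g (Suc n) = a (Suc (Suc n)))"

text \<open>A digit is cleared when the carry passes it and raised when the carry stops at it. The
  rule for digit \<open>n\<close> reads only digits up to \<open>n + 1\<close>, so it is continuous,
  makes sense for infinite words, and sends a word whose carry never stops to zero.\<close>

definition suc_word :: "(nat \<Rightarrow> nat) \<Rightarrow> nat \<Rightarrow> nat" where
  "suc_word g n = (if carry g (Suc n) \<or> carry g (Suc (Suc n)) then 0 else g n + of_bool (carry g n))"

text \<open>Since \<open>carry\<close> advances in steps of two, two consecutive failures exclude
  all later carries; \<open>c\<close> is the place where the one is added.\<close>

definition top_carry :: "(nat \<Rightarrow> nat) \<Rightarrow> nat \<Rightarrow> bool" where
  "top_carry g c \<longleftrightarrow> carry g c \<and> \<not> carry g (Suc c) \<and> \<not> carry g (Suc (Suc c))"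

lemma carry_cong: "(\<And>j. j < n \<Longrightarrow> g j = h j) \<Longrightarrow> carry g n = carry h n"
  by (induction g n rule: carry.induct) auto

lemma carry_prefix: "g \<in> W \<Longrightarrow> carry g n \<Longrightarrow> (\<Sum>j<n. g j * q j) + 1 = q n"
proof (induction g n rule: carry.induct)
  case (3 g n)
  then show ?case using W_prev[of g n] by simp
qed (auto simp: W_0 a1)

lemma carry_digit: "carry g (Suc n) \<Longrightarrow> 1 \<le> n \<Longrightarrow> g n = a (Suc n)"
  by (cases n) auto

text \<open>Consecutive carries would need two adjacent maximal digits. Positions \<open>0\<close>
  and \<open>1\<close> always carry, hence the bound on \<open>n\<close>.\<close>

lemma carry_not_suc:
  assumes "g \<in> W" "carry g n" "2 \<le> n"
  shows "\<not> carry g (Suc n)"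
proof
  assume "carry g (Suc n)"
  then have "g n = a (Suc n)" using carry_digit assms by simp
  obtain m where m: "n = Suc m" "1 \<le> m" using assms by (cases n) auto
  have "g m = 0" using W_prev[OF assms(1), of m] \<open>g n = a (Suc n)\<close> m by simp
  moreover have "g m = a (Suc m)" using carry_digit[of g m] assms m by simp
  ultimately show False using a_pos[of m] by simp
qed

lemma carry_down: "carry g c \<Longrightarrow> n < c \<Longrightarrow> carry g (Suc n) \<or> carry g (Suc (Suc n))"
proof (induction g c rule: carry.induct)
  case (3 g m)
  then show ?case by (cases "n < m") (auto simp: less_Suc_eq)
qed auto

lemma not_carry_above:
  assumes "\<not> carry g i" "\<not> carry g (Suc i)" "i \<le> n"
  shows "\<not> carry g n"
  using assms(3)
proof (induction n rule: less_induct)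
  case (less n)
  show ?case
  proof (cases "n = i \<or> n = Suc i")
    case False
    then obtain m where "n = Suc (Suc m)" "i \<le> m"
      using less.prems by (metis Suc_le_D le_SucE le_neq_implies_less Suc_leI)
    then show ?thesis using less.IH[of m] by simp
  qed (use assms in auto)
qed

lemma top_carry_exists:
  assumes "\<not> carry g i" "\<not> carry g (Suc i)"
  shows "\<exists>c<i. top_carry g c"
proof -
  let ?c = "Max {n. carry g n}"
  have fin: "finite {n. carry g n}"
    unfolding finite_nat_set_iff_bounded using not_carry_above[OF assms] not_le by blast
  have ne: "{n. carry g n} \<noteq> {}" using carry.simps(1)[of g] by blast
  have c: "carry g ?c" using Max_in[OF fin ne] by simp
  moreover have "\<not> carry g n" if "?c < n" for n using Max_ge[OF fin, of n] that by auto
  moreover have "?c < i" using c not_carry_above[OF assms] not_le by blast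
  ultimately show ?thesis unfolding top_carry_def by (meson lessI less_SucI)
qed

lemma suc_word_below: "carry g c \<Longrightarrow> n < c \<Longrightarrow> suc_word g n = 0"
  using carry_down by (auto simp: suc_word_def)

lemma suc_word_top:
  assumes "top_carry g c"
  shows "suc_word g n = (if n < c then 0 else if n = c then Suc (g c) else g n)"
proof -
  have "\<not> carry g n" if "c < n" for n
    using not_carry_above[of g "Suc c" n] assms that by (auto simp: top_carry_def)
  then have "suc_word g n = (if n = c then Suc (g c) else g n)" if "c \<le> n"
    using that assms by (auto simp: suc_word_def top_carry_def simp del: carry.simps(3))
  then show ?thesis
    using suc_word_below[of g c n] assms by (auto simp: top_carry_def)
qed

lemma suc_word_W:
  assumes g: "g \<in> W"
  shows "suc_word g \<in> W"
  unfolding W_iff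
proof (intro conjI allI impI)
  show "suc_word g 0 = 0" by (simp add: suc_word_def)
next
  fix n
  show "suc_word g n \<le> a (Suc n)"
  proof (rule ccontr)
    assume "\<not> ?thesis"
    then have n: "carry g n" "\<not> carry g (Suc n)" "\<not> carry g (Suc (Suc n))" "g n = a (Suc n)"
      using W_le[OF g, of n]
      by (auto simp: suc_word_def of_bool_def simp del: carry.simps(3) split: if_splits)
    \<comment> \<open>An overflow needs a maximal digit \<open>n\<close> with a carry into it. That
      carry makes digit \<open>n - 1\<close> maximal too, which is forbidden; for
      \<open>n = 1\<close> the carry would continue to position \<open>2\<close> instead of
      stopping.\<close>
    have "n \<noteq> 0" using n by (metis carry.simps(2) One_nat_def)
    then obtain m where m: "n = Suc m" by (cases n) auto
    show False
    proof (cases "m = 0")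
      case True
      then show ?thesis using n m by simp
    next
      case False
      then have "g m = a (Suc m)" using n m carry_digit[of g m] by simp
      moreover have "g m = 0" using W_prev[OF g] n m by simp
      ultimately show ?thesis using a_pos[of m] by simp
    qed
  qed
next
  fix n
  assume *: "suc_word g (Suc n) = a (Suc (Suc n))"
  show "suc_word g n = 0"
  proof (rule ccontr)
    assume "suc_word g n \<noteq> 0"
    then have n: "\<not> carry g (Suc n)" "\<not> carry g (Suc (Suc n))" "g n \<noteq> 0 \<or> carry g n"
      by (auto simp: suc_word_def simp del: carry.simps(3) split: if_splits)
    \<comment> \<open>Digit \<open>n + 1\<close> receives no carry, so it was already maximal in
      \<open>g\<close> and \<open>g n = 0\<close>; a carry into \<open>n\<close> would then extend
      to \<open>n + 2\<close>.\<close>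
    then have "g (Suc n) = a (Suc (Suc n))"
      using * by (auto simp: suc_word_def simp del: carry.simps split: if_splits)
    then show False using n W_prev[OF g, of n] by auto
  qed
qed

lemma suc_word_FW:
  assumes g: "g \<in> FW"
  shows "suc_word g \<in> FW" and "val (suc_word g) = val g + 1"
proof -
  have gW: "g \<in> W" using g by (simp add: FW_iff)
  obtain M0 where M0: "\<forall>n\<ge>M0. g n = 0" using g unfolding FW_iff by blast
  define M where "M = Suc M0"
  have M: "g n = 0" if "n \<ge> M" for n using M0 that by (simp add: M_def)
  have nc: "\<not> carry g (Suc n)" if "n \<ge> M" for n
    using carry_digit[of g n] M[OF that] that a_pos[of n] by (auto simp: M_def)
  obtain c where c: "c < Suc M" "top_carry g c"
    using top_carry_exists[of g "Suc M"] nc[of M] nc[of "Suc M"] by auto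
  note S = suc_word_top[OF c(2)]
  have S0: "suc_word g n = 0" if "n \<ge> Suc M" for n
    using S M c(1) that by auto
  then show "suc_word g \<in> FW"
    using suc_word_W gW unfolding FW_iff by blast
  have split: "(\<Sum>n<Suc M. u n) = (\<Sum>n<c. u n) + (\<Sum>n\<in>{c..<Suc M}. u n)" for u :: "nat \<Rightarrow> nat"
    using c(1) by (simp add: lessThan_atLeast0 sum.atLeastLessThan_concat)
  have "val (suc_word g) = (\<Sum>n<Suc M. suc_word g n * q n)"
    by (rule val_eq[OF S0])
  also have "\<dots> = (\<Sum>n\<in>{c..<Suc M}. suc_word g n * q n)"
    unfolding split using S by simp
  also have "\<dots> = (\<Sum>n\<in>{c..<Suc M}. g n * q n + (if n = c then q n else 0))"
    using S by (intro sum.cong) auto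
  also have "\<dots> = (\<Sum>n\<in>{c..<Suc M}. g n * q n) + q c"
    using c(1) by (simp only: sum.distrib) (simp add: sum.delta)
  \<comment> \<open>The cleared prefix was worth \<open>q c - 1\<close>, so exchanging it for one
    copy of \<open>q c\<close> gains exactly one.\<close>
  also have "\<dots> = (\<Sum>n<Suc M. g n * q n) + 1"
    unfolding split using carry_prefix[OF gW, of c] c(2) by (simp add: top_carry_def)
  also have "(\<Sum>n<Suc M. g n * q n) = val g"
    using val_eq[of "Suc M" g] M by simp
  finally show "val (suc_word g) = val g + 1" .
qed

subsection \<open>The embedding into the line\<close>

text \<open>Digit \<open>n + 1\<close> is at most \<open>a (n + 2)\<close>, so this divisor keeps
  its contribution below \<open>weight n / 4\<close> however large the partial quotients
  are.\<close>

primrec weight :: "nat \<Rightarrow> real" where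
  "weight 0 = 1"
| "weight (Suc n) = weight n / (4 * real (a (Suc (Suc n))))"

text \<open>By \<open>carry_parity\<close> this is the \<open>parity\<close> of the maximal word
  below \<open>n\<close>.\<close>

fun orient :: "nat \<Rightarrow> real" where
  "orient 0 = 1"
| "orient (Suc 0) = 1"
| "orient (Suc (Suc n)) = - orient n"

definition side :: "nat \<Rightarrow> nat \<Rightarrow> real" where
  "side n m = (if m = 1 then - orient n else orient n)"

text \<open>
  \<open>psign g n\<close> is the sign with which a nonzero \<open>n\<close>-th digit enters the series, or \<open>0\<close> if all
  earlier digits vanish; in the latter case the digit is the leading one and \<open>esign\<close> takes its
  sign from \<open>side\<close>.
\<close>

primrec psign :: "(nat \<Rightarrow> nat) \<Rightarrow> nat \<Rightarrow> real" where
  "psign g 0 = 0"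
| "psign g (Suc n) = (if g n = 0 then psign g n else if psign g n = 0 then - side n (g n) else - psign g n)"

definition esign :: "(nat \<Rightarrow> nat) \<Rightarrow> nat \<Rightarrow> real" where
  "esign g n = (if psign g n = 0 then side n (g n) else psign g n)"

definition parity :: "(nat \<Rightarrow> nat) \<Rightarrow> nat \<Rightarrow> real" where
  "parity g n = (\<Prod>j<n. if g j = 0 then 1 else -1)"

definition digit_term :: "(nat \<Rightarrow> nat) \<Rightarrow> nat \<Rightarrow> real" where
  "digit_term g n = real (g n) * weight n * esign g n"

definition pt :: "(nat \<Rightarrow> nat) \<Rightarrow> real" where
  "pt g = (\<Sum>n. digit_term g n)"

lemma weight_pos: "0 < weight n"
  by (induction n) auto

lemma weight_le: "weight (n + k) \<le> weight n * (1 / 4) ^ k"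
proof (induction k)
  case (Suc k)
  have "1 \<le> real (a (Suc (Suc (n + k))))" by (simp add: Suc_le_eq)
  then have "weight (n + k) / (4 * real (a (Suc (Suc (n + k))))) \<le> weight (n + k) / 4"
    using weight_pos[of "n + k"] by (intro divide_left_mono) auto
  then show ?case using Suc by simp
qed simp

lemma orient_abs: "\<bar>orient n\<bar> = 1"
  by (induction n rule: orient.induct) auto

lemma side_abs: "\<bar>side n m\<bar> = 1"
  by (simp add: side_def orient_abs)

lemma psign_abs: "psign g n \<noteq> 0 \<Longrightarrow> \<bar>psign g n\<bar> = 1"
  by (induction n) (auto simp: side_abs split: if_splits)

lemma esign_abs: "\<bar>esign g n\<bar> = 1"
  by (simp add: esign_def side_abs psign_abs)

lemma parity_Suc: "parity g (Suc n) = parity g n * (if g n = 0 then 1 else -1)"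
  by (simp add: parity_def)

lemma parity_abs: "\<bar>parity g n\<bar> = 1"
  by (induction n) (auto simp: parity_Suc parity_def)

lemma psign_cong: "(\<And>j. j < n \<Longrightarrow> g j = h j) \<Longrightarrow> psign g n = psign h n"
  by (induction n) auto

lemma parity_cong: "(\<And>j. j < n \<Longrightarrow> g j = h j) \<Longrightarrow> parity g n = parity h n"
  unfolding parity_def by (intro prod.cong) auto

lemma psign_zero: "(\<And>j. j < n \<Longrightarrow> g j = 0) \<Longrightarrow> psign g n = 0"
  by (induction n) auto

lemma parity_zero: "(\<And>j. j < n \<Longrightarrow> g j = 0) \<Longrightarrow> parity g n = 1"
  unfolding parity_def by (intro prod.neutral) auto

lemma digit_term_cong:
  assumes "\<And>j. j \<le> n \<Longrightarrow> g j = h j"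
  shows "digit_term g n = digit_term h n"
  using assms psign_cong[of n g h] by (simp add: digit_term_def esign_def)

lemma digit_term_le:
  assumes "g \<in> W"
  shows "\<bar>digit_term g (n + Suc i)\<bar> \<le> weight i / 4 * (1 / 4) ^ n"
proof -
  have "\<bar>digit_term g (Suc (n + i))\<bar> = real (g (Suc (n + i))) * weight (Suc (n + i))"
    using weight_pos[of "Suc (n + i)"] esign_abs[of g "Suc (n + i)"]
    by (simp add: digit_term_def abs_mult del: weight.simps)
  also have "\<dots> \<le> real (a (Suc (Suc (n + i)))) * weight (Suc (n + i))"
    using W_le[OF assms, of "Suc (n + i)"] weight_pos[of "Suc (n + i)"]
    by (intro mult_right_mono) auto
  also have "\<dots> = weight (n + i) / 4" by simp
  also have "\<dots> \<le> weight i / 4 * (1 / 4) ^ n"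
    using weight_le[of i n] by (simp add: add.commute)
  finally show ?thesis by simp
qed

lemma digit_term_tail:
  assumes "g \<in> W"
  shows "summable (digit_term g)" and "\<bar>\<Sum>n. digit_term g (n + Suc i)\<bar> \<le> weight i / 3"
proof -
  have geo: "(\<lambda>n. weight i / 4 * (1 / 4) ^ n) sums (weight i / 4 * (1 / (1 - 1 / 4)))"
    by (intro sums_mult geometric_sums) auto
  have sm: "summable (\<lambda>n. \<bar>digit_term g (n + Suc i)\<bar>)"
    by (rule summable_comparison_test'[OF sums_summable[OF geo], of 0])
      (simp only: real_norm_def abs_idempotent digit_term_le[OF assms])
  then have "summable (\<lambda>n. digit_term g (n + Suc i))"
    by (rule summable_rabs_cancel)
  then show "summable (digit_term g)" using summable_iff_shift by blast
  have "\<bar>\<Sum>n. digit_term g (n + Suc i)\<bar> \<le> (\<Sum>n. \<bar>digit_term g (n + Suc i)\<bar>)"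
    using sm by (rule summable_rabs)
  also have "\<dots> \<le> (\<Sum>n. weight i / 4 * (1 / 4) ^ n)"
    by (intro suminf_le digit_term_le[OF assms] sums_summable[OF geo] sm)
  also have "\<dots> = weight i / 3" using sums_unique[OF geo] by simp
  finally show "\<bar>\<Sum>n. digit_term g (n + Suc i)\<bar> \<le> weight i / 3" .
qed

lemma pt_split:
  assumes "g \<in> W"
  obtains r where "pt g = (\<Sum>n<i. digit_term g n) + digit_term g i + r" "\<bar>r\<bar> \<le> weight i / 3"
proof
  show "pt g = (\<Sum>n<i. digit_term g n) + digit_term g i + (\<Sum>n. digit_term g (n + Suc i))"
    unfolding pt_def using suminf_split_initial_segment[OF digit_term_tail(1)[OF assms], of "Suc i"]
    by simp
qed (rule digit_term_tail(2)[OF assms])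

lemma pt_close:
  assumes "g \<in> W" "h \<in> W" and eq: "\<And>j. j \<le> i \<Longrightarrow> g j = h j"
  shows "\<bar>pt g - pt h\<bar> \<le> weight i"
proof -
  obtain r where r: "pt g = (\<Sum>n<i. digit_term g n) + digit_term g i + r" "\<bar>r\<bar> \<le> weight i / 3"
    using pt_split[OF assms(1)] .
  obtain r' where r': "pt h = (\<Sum>n<i. digit_term h n) + digit_term h i + r'" "\<bar>r'\<bar> \<le> weight i / 3"
    using pt_split[OF assms(2)] .
  have "(\<Sum>n<i. digit_term g n) = (\<Sum>n<i. digit_term h n)" "digit_term g i = digit_term h i"
    using eq by (auto intro!: sum.cong digit_term_cong)
  then have "\<bar>pt g - pt h\<bar> = \<bar>r - r'\<bar>" using r(1) r'(1) by simp
  then show ?thesis using r(2) r'(2) weight_pos[of i] by linarith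
qed

lemma pt_abs_less_1:
  assumes "g \<in> W"
  shows "\<bar>pt g\<bar> < 1"
proof -
  obtain r where r: "pt g = (\<Sum>n<0. digit_term g n) + digit_term g 0 + r" "\<bar>r\<bar> \<le> weight 0 / 3"
    using pt_split[OF assms, of 0] .
  then show ?thesis using W_0[OF assms] by (simp add: digit_term_def)
qed

lemma pt_zero: "pt (\<lambda>_. 0) = 0"
  by (simp add: pt_def digit_term_def)

text \<open>The digits differ by at least one, worth \<open>weight i\<close>, and the two tails
  together by at most \<open>2 * weight i / 3\<close>. The sign of the larger digit decides; if the
  smaller one has the opposite sign, this only widens the gap.\<close>

lemma pt_compare:
  assumes g: "g \<in> W" and h: "h \<in> W" and eq: "\<And>j. j < i \<Longrightarrow> g j = h j" and less: "g i < h i"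
  shows "0 < esign h i * (pt h - pt g)"
proof -
  obtain r where r: "pt g = (\<Sum>n<i. digit_term g n) + digit_term g i + r" "\<bar>r\<bar> \<le> weight i / 3"
    using pt_split[OF g] .
  obtain r' where r': "pt h = (\<Sum>n<i. digit_term h n) + digit_term h i + r'" "\<bar>r'\<bar> \<le> weight i / 3"
    using pt_split[OF h] .
  have "(\<Sum>n<i. digit_term g n) = (\<Sum>n<i. digit_term h n)"
    using eq by (auto intro!: sum.cong digit_term_cong)
  then have diff: "pt h - pt g = digit_term h i - digit_term g i + (r' - r)" using r(1) r'(1) by simp
  have e: "\<bar>esign h i\<bar> = 1" "\<bar>esign g i\<bar> = 1" by (auto simp: esign_abs)
  have "esign h i * digit_term h i = real (h i) * weight i"
    using e by (auto simp: digit_term_def abs_if split: if_splits)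
  moreover have "esign h i * digit_term g i \<le> real (g i) * weight i"
  proof -
    have "\<bar>esign h i * digit_term g i\<bar> = real (g i) * weight i"
      using e weight_pos[of i] by (simp add: digit_term_def abs_mult)
    then show ?thesis by linarith
  qed
  moreover have "\<bar>esign h i * (r' - r)\<bar> \<le> 2 * weight i / 3"
  proof -
    have "\<bar>r' - r\<bar> \<le> 2 * weight i / 3" using r(2) r'(2) by linarith
    then show ?thesis using e by (simp add: abs_mult)
  qed
  moreover have "(real (g i) + 1) * weight i \<le> real (h i) * weight i"
    using less weight_pos[of i] by (intro mult_right_mono) auto
  moreover have "(real (g i) + 1) * weight i = real (g i) * weight i + weight i"
    by (simp add: distrib_right)
  moreover have "esign h i * (pt h - pt g)
      = esign h i * digit_term h i - esign h i * digit_term g i + esign h i * (r' - r)"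
    unfolding diff by (simp add: distrib_left right_diff_distrib)
  ultimately show ?thesis
    using weight_pos[of i] by linarith
qed

lemma pt_inj: "inj_on pt W"
proof (rule inj_onI, rule ccontr)
  fix g h assume W: "g \<in> W" "h \<in> W" and eq: "pt g = pt h" and "g \<noteq> h"
  then obtain i where i: "\<And>j. j < i \<Longrightarrow> g j = h j" "g i \<noteq> h i"
    using first_difference by metis
  then show False
    using pt_compare[OF W, of i] pt_compare[OF W(2,1), of i] eq by (auto simp: neq_iff)
qed

section \<open>Adding one and the order of points\<close>

lemma sgn_pt_leading:
  assumes "g \<in> W" "\<And>j. j < i \<Longrightarrow> g j = 0" "g i \<noteq> 0"
  shows "sgn (pt g) = side i (g i)"
proof -
  have "0 < esign g i * (pt g - pt (\<lambda>_. 0))"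
    using assms by (intro pt_compare zero_W) auto
  moreover have "esign g i = side i (g i)"
    using psign_zero[of i g] assms by (simp add: esign_def)
  ultimately show ?thesis
    using side_abs[of i "g i"] by (auto simp: pt_zero abs_if sgn_if zero_less_mult_iff split: if_splits)
qed

text \<open>The leading digit has the sign of \<open>pt g\<close>; each later nonzero digit flips
  \<open>psign\<close> and \<open>parity\<close> together, so their ratio stays fixed.\<close>

lemma esign_eq:
  assumes g: "g \<in> W" and nz: "g i \<noteq> 0"
  shows "esign g i = sgn (pt g) * parity g i"
proof -
  obtain l where l: "\<And>j. j < l \<Longrightarrow> g j = 0" "g l \<noteq> 0"
    using first_difference[of g "\<lambda>_. 0"] nz by metis
  have s: "sgn (pt g) = side l (g l)" using sgn_pt_leading[OF g l] .
  have "l \<le> i" using l(1)[of i] nz by linarith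
  show ?thesis
  proof (cases "l = i")
    case True
    then show ?thesis using l s psign_zero[of l g] parity_zero[of l g] by (simp add: esign_def)
  next
    case False
    then have "Suc l \<le> i" using \<open>l \<le> i\<close> by simp
    then have "psign g i = side l (g l) * parity g i"
    proof (induction i rule: dec_induct)
      case base
      then show ?case using l psign_zero[of l g] parity_zero[of l g] by (simp add: parity_Suc)
    next
      case (step n)
      then have "psign g n \<noteq> 0"
        using side_abs[of l "g l"] parity_abs[of g n] by auto
      then show ?case using step by (simp add: parity_Suc)
    qed
    moreover from this have "psign g i \<noteq> 0"
      using side_abs[of l "g l"] parity_abs[of g i] by auto
    ultimately show ?thesis using s by (simp add: esign_def)
  qed
qed

text \<open>Two steps of the carry pass one zero and one nonzero digit, hence one reversal, matching
  the recursion of \<open>orient\<close>.\<close>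

lemma carry_parity: "g \<in> W \<Longrightarrow> carry g n \<Longrightarrow> parity g n = orient n"
proof (induction g n rule: carry.induct)
  case (3 g n)
  then show ?case using W_prev[of g n] by (simp add: parity_Suc)
qed (auto simp: parity_def W_0)

text \<open>The successor starts at \<open>c\<close>. If \<open>g c = 0\<close>, its digit there is
  \<open>1\<close>, on side \<open>- orient c\<close>; otherwise the digit is at least
  \<open>2\<close>, on side \<open>orient c\<close>. Either way the sign after \<open>c\<close> is
  \<open>parity g (Suc c)\<close>, which is why \<open>side\<close> singles out the digit
  \<open>1\<close>.\<close>

lemma psign_suc_word:
  assumes g: "g \<in> W" and c: "top_carry g c" and i: "Suc c \<le> i"
  shows "psign (suc_word g) i = parity g i"
  using i
proof (induction i rule: dec_induct)
  case base
  have "psign (suc_word g) c = 0" by (rule psign_zero) (simp add: suc_word_top[OF c])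
  moreover have "parity g c = orient c" using carry_parity g c by (simp add: top_carry_def)
  ultimately show ?case by (simp add: suc_word_top[OF c, of c] parity_Suc side_def)
next
  case (step n)
  then show ?case
    using parity_abs[of g n] by (auto simp: suc_word_top[OF c, of n] parity_Suc)
qed

text \<open>
  The condition on \<open>i\<close> excludes comparing a word that starts with \<open>q 1\<close> with one that
  starts with \<open>q 2\<close>. These lie on different sides of \<open>0\<close>, and their successors
  interleave: both families contain a preimage of \<open>0\<close>.
\<close>

lemma suc_word_compare:
  assumes g: "g \<in> W" and h: "h \<in> W" and eq: "\<And>j. j < i \<Longrightarrow> g j = h j" and less: "g i < h i"
    and i: "2 \<le> i \<or> g 2 = 0"
  shows "0 < parity h i * (pt (suc_word h) - pt (suc_word g))"
proof -
  have W: "suc_word g \<in> W" "suc_word h \<in> W" using suc_word_W g h by auto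
  have "i \<noteq> 0" using W_0[OF h] less by (cases i) auto
  have par: "parity g i = parity h i" using eq by (rule parity_cong)
  have carry_eq: "carry g n = carry h n" if "n \<le> i" for n
    using carry_cong[of n g h] eq that by simp
  have g_not_max: "g i \<noteq> a (Suc i)" using W_le[OF h, of i] less by simp
  then have ng: "\<not> carry g (Suc i)" using carry_digit[of g i] \<open>i \<noteq> 0\<close> by auto
  show ?thesis
  proof (cases "i = 1")
    case True
    then have dig: "h 1 = 1" "g 1 = 0" "g 2 = 0" "h 0 = 0"
      using W_le[OF h, of 1] less i a2 W_0[OF h] by (auto simp: numeral_2_eq_2)
    \<comment> \<open>The carry in \<open>h\<close> passes position \<open>1\<close>, so its
      successor vanishes below \<open>2\<close>, while that of \<open>g\<close> leads with the digit
      \<open>1\<close> at position \<open>1\<close>.\<close>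
    have "top_carry g 1" using dig by (simp add: top_carry_def numeral_2_eq_2 a2 a3)
    then have Sg: "suc_word g n = (if n < 1 then 0 else if n = 1 then 1 else g n)" for n
      using suc_word_top[of g 1 n] dig by simp
    have "carry h 2" using dig by (simp add: numeral_2_eq_2 a2)
    then have Sh: "suc_word h n = 0" if "n < 2" for n using that by (rule suc_word_below)
    have "0 < esign (suc_word g) 1 * (pt (suc_word g) - pt (suc_word h))"
      using W Sg Sh by (intro pt_compare) auto
    moreover have "esign (suc_word g) 1 = -1"
      using psign_zero[of 1 "suc_word g"] Sg by (simp add: esign_def side_def)
    moreover have "parity h i = 1" using True dig by (intro parity_zero) auto
    ultimately show ?thesis by simp
  next
    case False
    then have i2: "2 \<le> i" using \<open>i \<noteq> 0\<close> by simp
    then obtain k where k: "i = Suc k" "1 \<le> k" by (cases i) auto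
    consider (carry) "carry h i" | (absorb) "\<not> carry h i" "carry h (Suc i)"
      | (inner) "\<not> carry h i" "\<not> carry h (Suc i)" by blast
    then show ?thesis
    proof cases
      case carry
      \<comment> \<open>Both prefixes are maximal and get cleared. Digit \<open>i\<close> of the
        successor of \<open>h\<close> is at least \<open>2\<close>, and its side
        \<open>orient i\<close> is \<open>parity h i\<close>.\<close>
      then have "carry g i" using carry_eq by simp
      have "\<not> carry h (Suc i)" using carry_not_suc[OF h carry i2] .
      moreover have "\<not> carry h (Suc (Suc i))" using W_prev[OF h, of i] less by auto
      ultimately have "top_carry h i" using carry by (simp add: top_carry_def)
      then have Sh: "suc_word h n = (if n < i then 0 else if n = i then Suc (h i) else h n)" for n
        by (rule suc_word_top)
      have "0 < esign (suc_word h) i * (pt (suc_word h) - pt (suc_word g))"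
      proof (rule pt_compare[OF W])
        show "suc_word g j = suc_word h j" if "j < i" for j
          using suc_word_below[OF \<open>carry g i\<close> that] Sh that by simp
        show "suc_word g i < suc_word h i"
          using Sh[of i] less by (simp add: suc_word_def[of g] of_bool_def)
      qed
      moreover have "esign (suc_word h) i = orient i"
        using psign_zero[of i "suc_word h"] Sh less by (simp add: esign_def side_def)
      ultimately show ?thesis using carry_parity[OF h carry] by simp
    next
      case absorb
      \<comment> \<open>The maximal digit \<open>h i\<close> prolongs the carry and clears the
        successor of \<open>h\<close> through \<open>i\<close>, whereas that of \<open>g\<close>
        leads with \<open>1\<close> at \<open>k = i - 1\<close>, on side
        \<open>- orient k\<close>.\<close>
      then have hk: "carry h k" "h i = a (Suc i)" using k by auto
      then have "h k = 0" using W_prev[OF h, of k] k by simp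
      have "top_carry g k"
        using carry_eq[of k] carry_eq[of i] hk(1) absorb(1) ng k by (auto simp: top_carry_def simp del: carry.simps(3))
      then have Sg: "suc_word g n = (if n < k then 0 else if n = k then 1 else g n)" for n
        using suc_word_top[of g k n] eq[of k] \<open>h k = 0\<close> k by simp
      have Sh: "suc_word h n = 0" if "n < Suc i" for n using suc_word_below[OF absorb(2) that] .
      have "0 < esign (suc_word g) k * (pt (suc_word g) - pt (suc_word h))"
        using W Sg Sh k by (intro pt_compare) auto
      moreover have "esign (suc_word g) k = - orient k"
        using psign_zero[of k "suc_word g"] Sg by (simp add: esign_def side_def)
      moreover have "parity h i = orient k"
        using carry_parity[OF h hk(1)] \<open>h k = 0\<close> k by (simp add: parity_Suc)
      ultimately show ?thesis by (simp add: algebra_simps)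
    next
      case inner
      \<comment> \<open>The carry stops below \<open>i\<close>, at the same place in both words, so
        digit \<open>i\<close> survives and \<open>psign_suc_word\<close> gives its sign.\<close>
      then obtain c where c: "c < i" "top_carry h c" using top_carry_exists by blast
      \<comment> \<open>Only for \<open>i = c + 1\<close> does this involve digit \<open>i\<close>,
        where the words differ; then neither word carries.\<close>
      have "carry g (Suc (Suc c)) = carry h (Suc (Suc c))"
      proof (cases "Suc (Suc c) \<le> i")
        case False
        then have "Suc (Suc c) = Suc i" using c(1) by simp
        then show ?thesis using ng inner(2) by simp
      qed (rule carry_eq)
      then have c': "top_carry g c"
        using c carry_eq[of c] carry_eq[of "Suc c"] by (simp add: top_carry_def del: carry.simps(3))
      have "0 < esign (suc_word h) i * (pt (suc_word h) - pt (suc_word g))"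
        using eq less c(1) by (intro pt_compare W) (auto simp: suc_word_top[OF c(2)] suc_word_top[OF c'])
      moreover have "esign (suc_word h) i = parity h i"
        using psign_suc_word[OF h c(2), of i] c(1) parity_abs[of h i] by (auto simp: esign_def)
      ultimately show ?thesis by simp
    qed
  qed
qed

text \<open>The product form says that on each half the successor's point grows with the distance
  from \<open>0\<close>. Both differences have the sign \<open>parity h i\<close>, by
  \<open>pt_compare\<close> with \<open>esign_eq\<close> and by \<open>suc_word_compare\<close>, so
  the sign cancels.\<close>

lemma suc_word_unimodal:
  assumes g: "g \<in> W" and h: "h \<in> W" and "g \<noteq> h" and same: "0 \<le> pt g * pt h"
  shows "0 < (\<bar>pt h\<bar> - \<bar>pt g\<bar>) * (pt (suc_word h) - pt (suc_word g))"
proof -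
  have main: "0 < (\<bar>pt h\<bar> - \<bar>pt g\<bar>) * (pt (suc_word h) - pt (suc_word g))"
    if g: "g \<in> W" and h: "h \<in> W" and eq: "\<And>j. j < i \<Longrightarrow> g j = h j" and less: "g i < h i"
      and same: "0 \<le> pt g * pt h" for g h i
  proof -
    \<comment> \<open>The pair excluded from \<open>suc_word_compare\<close> leads with
      \<open>q 1\<close> and \<open>q 2\<close>, on opposite sides of \<open>0\<close>.\<close>
    have "2 \<le> i \<or> g 2 = 0"
    proof (rule ccontr)
      assume "\<not> ?thesis"
      then have i: "i < 2" "g 2 \<noteq> 0" by auto
      moreover have "i \<noteq> 0" using W_0[OF h] less by (cases i) auto
      ultimately have "i = 1" by simp
      then have "g 1 = 0" "h 1 = 1" using less W_le[OF h, of 1] a2 by auto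
      moreover have "g 2 = 1" using i W_le[OF g, of 2] a3 by (simp add: numeral_2_eq_2)
      moreover have "g 0 = 0" "h 0 = 0" using W_0 g h by auto
      ultimately have "sgn (pt g) = side 2 1" "sgn (pt h) = side 1 1"
        using sgn_pt_leading[OF g, of 2] sgn_pt_leading[OF h, of 1]
        by (auto simp: less_2_cases_iff)
      then have "pt g > 0" "pt h < 0"
        by (auto simp: side_def numeral_2_eq_2 sgn_if split: if_splits)
      then show False using same by (simp add: zero_le_mult_iff)
    qed
    from suc_word_compare[OF g h eq less this]
    have 1: "0 < parity h i * (pt (suc_word h) - pt (suc_word g))" .
    have "0 < parity h i * (sgn (pt h) * (pt h - pt g))"
      using pt_compare[OF g h eq less] esign_eq[OF h, of i] less by (simp add: ac_simps)
    moreover have "sgn (pt h) * (pt h - pt g) = \<bar>pt h\<bar> - \<bar>pt g\<bar>" if "pt h \<noteq> 0"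
      using same that by (auto simp: sgn_if abs_if zero_le_mult_iff)
    ultimately have 2: "0 < parity h i * (\<bar>pt h\<bar> - \<bar>pt g\<bar>)"
      by (cases "pt h = 0") auto
    show ?thesis
      using 1 2 parity_abs[of h i] by (auto simp: zero_less_mult_iff)
  qed
  obtain i where i: "\<And>j. j < i \<Longrightarrow> g j = h j" "g i \<noteq> h i"
    using first_difference[OF \<open>g \<noteq> h\<close>] by blast
  show ?thesis
  proof (cases "g i < h i")
    case True
    then show ?thesis using main[OF g h i(1)] same by blast
  next
    case False
    then have "0 < (\<bar>pt g\<bar> - \<bar>pt h\<bar>) * (pt (suc_word g) - pt (suc_word h))"
      using main[OF h g, of i] i same by (auto simp: mult.commute)
    then show ?thesis by (simp add: algebra_simps)
  qed
qed

subsection \<open>Topology and the unimodal map\<close>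

text \<open>The digit ranges are finite, so their product is compact, and each digit rule is closed
  because it involves at most two digits.\<close>

lemma compact_W: "compact W"
proof -
  have "compactin (product_topology (\<lambda>i. euclidean) UNIV) (PiE UNIV (\<lambda>n. {..a (Suc n)}))"
    by (subst compactin_PiE) (auto intro: finite_imp_compact)
  then have c: "compact (PiE UNIV (\<lambda>n. {..a (Suc n)}))"
    by (simp add: euclidean_product_topology)
  have eq: "W = PiE UNIV (\<lambda>n. {..a (Suc n)}) \<inter>
      ({g. g 0 = 0} \<inter> (\<Inter>n. {g. g (Suc n) \<noteq> a (Suc (Suc n))} \<union> {g. g n = 0}))"
    by (auto simp: W_iff PiE_def Pi_iff)
  show ?thesis
    unfolding eq by (intro compact_Int_closed c closed_Int closed_INT ballI closed_Un closed_digit)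
qed

lemma weight_tendsto: "weight \<longlonglongrightarrow> 0"
proof (rule tendsto_sandwich[of "\<lambda>_. 0"])
  show "(\<lambda>n. (1 / 4) ^ n :: real) \<longlonglongrightarrow> 0" by (rule LIMSEQ_realpow_zero) auto
  show "\<forall>\<^sub>F n in sequentially. 0 \<le> weight n" using weight_pos by (simp add: less_imp_le)
  show "\<forall>\<^sub>F n in sequentially. weight n \<le> (1 / 4) ^ n" using weight_le[of 0] by simp
qed simp

lemma weight_less: "0 < e \<Longrightarrow> \<exists>i. weight i < e"
  using order_tendstoD(2)[OF weight_tendsto] by (metis eventually_happens sequentially_bot)

lemma continuous_on_pt: "continuous_on W pt"
  unfolding continuous_on_def
proof (intro ballI tendstoI)
  fix g and e :: real assume g: "g \<in> W" and "0 < e"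
  obtain i where i: "weight i < e" using weight_less \<open>0 < e\<close> by blast
  have "\<forall>\<^sub>F h in at g within W. h \<in> W" by (simp add: eventually_at_filter)
  then show "\<forall>\<^sub>F h in at g within W. dist (pt h) (pt g) < e"
    using eventually_agree[of i g W]
  proof eventually_elim
    case (elim h)
    then show ?case using pt_close[of h g i] g i by (simp add: dist_real_def)
  qed
qed

lemma continuous_on_suc_word: "continuous_on W suc_word"
proof (rule continuous_on_coordinatewise_then_product)
  fix n
  show "continuous_on W (\<lambda>g. suc_word g n)"
    unfolding continuous_on_def
  proof (intro ballI tendsto_eventually)
    fix g assume "g \<in> W"
    show "\<forall>\<^sub>F h in at g within W. suc_word h n = suc_word g n"
      using eventually_agree[of "Suc (Suc n)" g W]
    proof eventually_elim
      case (elim h)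
      then have "carry h m = carry g m" if "m \<le> Suc (Suc n)" for m
        using carry_cong[of m h g] that by simp
      then show ?case using elim by (simp add: suc_word_def del: carry.simps)
    qed
  qed
qed

text \<open>On each half of the compact set \<open>K\<close> the map induced by
  \<open>suc_word\<close> is continuous and increasing in the distance from \<open>0\<close>; the
  halves are extended separately and glued at \<open>0\<close>.\<close>

lemma unimodal_exists:
  obtains f where "unimodal f" "\<And>g. g \<in> W \<Longrightarrow> f (pt g) = pt (suc_word g)"
proof -
  define K where "K = pt ` W"
  obtain Y where Y: "homeomorphism W K pt Y"
    using homeomorphism_compact[OF compact_W continuous_on_pt] pt_inj K_def by blast
  have Ypt: "Y (pt g) = g" if "g \<in> W" for g using Y that by (simp add: homeomorphism_def)
  define F0 where "F0 x = pt (suc_word (Y x))" for x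
  have F0: "F0 (pt g) = pt (suc_word g)" if "g \<in> W" for g using Ypt that by (simp add: F0_def)
  have Y1: "continuous_on K Y" "Y ` K = W" using Y by (auto simp: homeomorphism_def)
  have "continuous_on K (pt \<circ> (suc_word \<circ> Y))"
    using Y1 suc_word_W
    by (intro continuous_on_compose Y1(1) continuous_on_subset[OF continuous_on_pt]
        continuous_on_subset[OF continuous_on_suc_word]) auto
  then have contF0: "continuous_on K F0" by (simp add: F0_def[abs_def] o_def)
  have "closed K"
    unfolding K_def by (intro compact_imp_closed compact_continuous_image continuous_on_pt compact_W)
  have K0: "0 \<in> K" using pt_zero zero_W unfolding K_def by (metis imageI)
  have Kless: "\<bar>x\<bar> < 1" if "x \<in> K" for x using that pt_abs_less_1 by (auto simp: K_def)
  have F0K: "F0 x \<in> K" if "x \<in> K" for x using that suc_word_W F0 by (auto simp: K_def)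
  have F0less: "F0 x < F0 y" if "x \<in> K" "y \<in> K" "0 \<le> x * y" "\<bar>x\<bar> < \<bar>y\<bar>" for x y
  proof -
    obtain g h where gh: "g \<in> W" "h \<in> W" "x = pt g" "y = pt h"
      using \<open>x \<in> K\<close> \<open>y \<in> K\<close> by (auto simp: K_def)
    then have "0 < (\<bar>y\<bar> - \<bar>x\<bar>) * (F0 y - F0 x)"
      using suc_word_unimodal[of g h] that F0 by auto
    then show ?thesis using that by (simp add: zero_less_mult_iff)
  qed
  have half: "\<exists>F. strict_mono F \<and> continuous_on UNIV F \<and> F 1 = 1 \<and> (\<forall>x\<in>K. 0 \<le> e * x \<longrightarrow> F (e * x) = F0 x)"
    if "e = 1 \<or> e = -1" for e :: real
  proof -
    \<comment> \<open>The factor \<open>e\<close> moves the chosen half of \<open>K\<close> to the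
      nonnegative side. The two rays provide the unboundedness required for the extension, and the
      right one forces \<open>F 1 = 1\<close>; the pieces fit strictly because values on
      \<open>K\<close> stay below \<open>1\<close>.\<close>
    let ?M = "{x. e * x \<in> K} \<inter> {0..}"
    let ?K = "({..0} \<union> ?M) \<union> {1..}"
    define G where "G x = (if x \<le> 0 then x + F0 0 else if 1 \<le> x then x else F0 (e * x))" for x
    have e: "\<bar>e * x\<bar> = \<bar>x\<bar>" "e * (e * x) = x" for x using that by auto
    have M1: "x < 1" if "x \<in> ?M" for x using that Kless[of "e * x"] e by auto
    have GM: "G x = F0 (e * x)" if "x \<in> ?M" for x
      using that M1[OF that] by (auto simp: G_def)
    have "closed ((\<lambda>x. e * x) -` K)"
      by (intro closed_vimage \<open>closed K\<close> continuous_intros)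
    then have clM: "closed ?M" by (auto simp: vimage_def intro!: closed_Int)
    have "continuous_on ?M (F0 \<circ> (\<lambda>x. e * x))"
      by (intro continuous_on_compose continuous_intros continuous_on_subset[OF contF0]) auto
    then have cM: "continuous_on ?M G"
      by (rule continuous_on_eq) (use GM in auto)
    have c0: "continuous_on {..0} G"
      by (rule continuous_on_eq[of _ "\<lambda>x. x + F0 0"]) (auto simp: G_def intro!: continuous_intros)
    have c1: "continuous_on {1..} G"
      by (rule continuous_on_eq[of _ "\<lambda>x. x"]) (auto simp: G_def)
    have cont: "continuous_on ?K G"
      by (intro continuous_on_closed_Un clM closed_Un c0 cM c1) auto
    have pos: "F0 0 < F0 (e * y)" if "y \<in> ?M" "0 < y" for y
      using F0less[OF K0, of "e * y"] that e[of y] by auto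
    have F0_less_1: "F0 x < 1" if "x \<in> K" for x using Kless[OF F0K[OF that]] by auto
    have G_less_1: "G x < 1" if "x \<in> ?K" "x < 1" for x
    proof (cases "x \<le> 0")
      case True
      then show ?thesis using F0_less_1[OF K0] by (simp add: G_def)
    next
      case False
      then show ?thesis using that F0_less_1 by (auto simp: G_def)
    qed
    have mono: "strict_mono_on ?K G"
    proof (rule strict_mono_onI)
      fix x y assume xy: "x \<in> ?K" "y \<in> ?K" "x < y"
      consider "y \<le> 0" | "1 \<le> x" | "x < 1" "1 \<le> y" | "x \<le> 0" "0 < y" "y < 1" | "0 < x" "y < 1"
        using xy by linarith
      then show "G x < G y"
      proof cases
        case 3
        then show ?thesis using G_less_1[OF xy(1)] by (simp add: G_def[of y])
      next
        case 4
        then show ?thesis using pos[of y] xy by (auto simp: G_def)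
      next
        case 5
        then have "x \<in> ?M" "y \<in> ?M" using xy by auto
        moreover from 5 have "0 \<le> (e * x) * (e * y)"
          using that xy by auto
        ultimately show ?thesis using F0less[of "e * x" "e * y"] e 5 xy GM by auto
      qed (use xy in \<open>auto simp: G_def\<close>)
    qed
    obtain F where F: "strict_mono F" "continuous_on UNIV F" "\<And>x. x \<in> ?K \<Longrightarrow> F x = G x"
    proof (rule strict_mono_on_closed_extension[OF _ cont mono])
      show "closed ?K" using clM by (intro closed_Un) auto
      show "\<exists>k\<in>?K. k \<le> x" for x by (rule bexI[of _ "min 0 x"]) auto
      show "\<exists>k\<in>?K. x \<le> k" for x by (rule bexI[of _ "max 1 x"]) auto
      show "\<exists>k\<in>?K. G k \<le> y" for y by (rule bexI[of _ "min 0 (y - F0 0)"]) (auto simp: G_def)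
      show "\<exists>k\<in>?K. y \<le> G k" for y by (rule bexI[of _ "max 1 y"]) (auto simp: G_def)
    qed blast
    have "F (e * x) = F0 x" if "x \<in> K" "0 \<le> e * x" for x
    proof -
      have "e * x \<in> ?M" using that by (simp add: e(2) del: mult_minus_left)
      then show ?thesis using F(3)[of "e * x"] GM[of "e * x"] e by auto
    qed
    moreover have "F 1 = 1" using F(3)[of 1] by (simp add: G_def)
    ultimately show ?thesis using F by blast
  qed
  obtain P where P: "strict_mono P" "continuous_on UNIV P" "P 1 = 1"
    "\<And>x. x \<in> K \<Longrightarrow> 0 \<le> x \<Longrightarrow> P x = F0 x"
    using half[of 1] by auto
  obtain N where N: "strict_mono N" "continuous_on UNIV N" "N 1 = 1"
    "\<And>x. x \<in> K \<Longrightarrow> x \<le> 0 \<Longrightarrow> N (- x) = F0 x"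
    using half[of "-1"] by auto
  define f where "f x = (if 0 \<le> x then P x else N (- x))" for x
  \<comment> \<open>Both extensions equal \<open>F0 0\<close> at \<open>0\<close>, so the second
    branch is valid there too.\<close>
  have fneg: "f x = N (- x)" if "x \<le> 0" for x
    using that P(4)[OF K0] N(4)[OF K0] by (auto simp: f_def)
  have f0: "f 0 \<in> K" using P(4)[OF K0] F0K[OF K0] by (simp add: f_def)
  have dec: "f y < f x" if "x < y" "y \<le> 0" for x y
    using that strict_monoD[OF N(1), of "- y" "- x"] by (simp add: fneg)
  have inc: "f x < f y" if "0 \<le> x" "x < y" for x y
    using that strict_monoD[OF P(1), of x y] by (simp add: f_def)
  have "continuous_on ({-1..0} \<union> {0..1}) f"
  proof (rule continuous_on_closed_Un)
    have "continuous_on {-1..0} (N \<circ> (\<lambda>x. - x))"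
      by (intro continuous_on_compose continuous_intros continuous_on_subset[OF N(2)]) auto
    then show "continuous_on {-1..0} f"
      by (rule continuous_on_eq) (simp add: fneg)
    show "continuous_on {0..1} f"
      by (rule continuous_on_eq[OF continuous_on_subset[OF P(2)]]) (auto simp: f_def)
  qed auto
  moreover have "{-1..0} \<union> {0..1} = {-1..1::real}" by auto
  ultimately have "continuous_on {-1..1} f" by simp
  moreover have ends: "f (-1) = 1" "f 1 = 1" using N(3) P(3) by (auto simp: f_def)
  moreover have "f x \<in> {-1..1}" if "x \<in> {-1..1}" for x
  proof -
    have "f 0 \<le> f x" using dec[of x 0] inc[of 0 x] by (cases "x = 0") (auto simp: neq_iff)
    moreover have "f x \<le> 1"
      using dec[of "-1" x] inc[of x 1] ends that by (cases "x \<le> 0"; cases "x = -1"; cases "x = 1") auto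
    ultimately show ?thesis using Kless[OF f0] by auto
  qed
  ultimately have "unimodal f" using dec inc unfolding unimodal_def by blast
  moreover have "f (pt g) = pt (suc_word g)" if "g \<in> W" for g
  proof -
    have "pt g \<in> K" using that by (simp add: K_def)
    then have "f (pt g) = F0 (pt g)" using P(4) N(4) by (simp add: f_def)
    then show ?thesis using F0 that by simp
  qed
  ultimately show ?thesis using that by blast
qed

subsection \<open>Recurrence of the critical orbit\<close>

lemma val_add:
  assumes "\<forall>n\<ge>M. g n = 0" "\<forall>n\<ge>M'. h n = 0"
  shows "val (\<lambda>n. g n + h n) = val g + val h"
proof -
  let ?M = "max M M'"
  have "val (\<lambda>n. g n + h n) = (\<Sum>n<?M. (g n + h n) * q n)" using assms by (intro val_eq) auto
  moreover have "val g = (\<Sum>n<?M. g n * q n)" using assms by (intro val_eq) auto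
  moreover have "val h = (\<Sum>n<?M. h n * q n)" using assms by (intro val_eq) auto
  ultimately show ?thesis by (simp add: distrib_right sum.distrib)
qed

lemma val_single: "val (\<lambda>n. if n = i then m else 0) = m * q i"
proof -
  have "val (\<lambda>n. if n = i then m else 0) = (\<Sum>n<Suc i. (if n = i then m else 0) * q n)"
    by (intro val_eq) auto
  also have "\<dots> = m * q i" by simp
  finally show ?thesis .
qed

lemma val_ge:
  assumes "g \<in> FW" "g i \<noteq> 0"
  shows "q i \<le> val g"
proof -
  have "g i * q i \<le> val g"
    unfolding ostrowski_val_def using assms
    by (intro member_le_sum) (auto simp: finite_ostrowski_words_def)
  moreover have "q i \<le> g i * q i" using assms by simp
  ultimately show ?thesis by linarith
qed

definition word :: "nat \<Rightarrow> nat \<Rightarrow> nat" where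
  "word k = (suc_word ^^ k) (\<lambda>_. 0)"

lemma suc_word_pow_FW:
  assumes "g \<in> FW"
  shows "(suc_word ^^ k) g \<in> FW \<and> val ((suc_word ^^ k) g) = val g + k"
  using assms suc_word_FW by (induction k) auto

lemma word_FW: "word k \<in> FW" and val_word: "val (word k) = k"
proof -
  have "(\<lambda>_. 0) \<in> FW" using zero_W by (auto simp: FW_iff)
  moreover have "val (\<lambda>_. 0) = 0" by (simp add: ostrowski_val_def)
  ultimately show "word k \<in> FW" "val (word k) = k"
    using suc_word_pow_FW by (auto simp: word_def)
qed

lemma word_leading:
  assumes "0 < k"
  obtains l where "\<And>j. j < l \<Longrightarrow> word k j = 0" "word k l \<noteq> 0" "1 \<le> l" "q l \<le> k"
proof -
  have "word k \<noteq> (\<lambda>_. 0)" using val_word[of k] assms by (auto simp: ostrowski_val_def)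
  then obtain l where l: "\<And>j. j < l \<Longrightarrow> word k j = 0" "word k l \<noteq> 0"
    using first_difference[of "word k" "\<lambda>_. 0"] by blast
  moreover have "l \<noteq> 0" using l(2) word_FW[of k] W_0[of "word k"] by (cases l) (auto simp: FW_iff)
  moreover have "q l \<le> k" using val_ge[OF word_FW l(2)] val_word by simp
  ultimately show ?thesis using that[of l] by simp
qed

lemma small_W:
  assumes "g 0 = 0" "\<And>j. 1 \<le> j \<Longrightarrow> g j < a (Suc j)"
  shows "g \<in> W"
proof -
  have "g n \<le> a (Suc n)" for n using assms by (cases n) (auto simp: less_imp_le)
  moreover have "g (Suc n) \<noteq> a (Suc (Suc n))" for n using assms(2)[of "Suc n"] by simp
  ultimately show ?thesis using assms(1) by (simp add: W_iff)
qed

lemma q_bracket: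
  assumes "1 \<le> k" "k \<le> q N" "1 \<le> N"
  shows "k \<in> q ` {1..N} \<or> (\<exists>i. 1 \<le> i \<and> i < N \<and> q i < k \<and> k < q (Suc i))"
  using assms(3,2)
proof (induction N rule: dec_induct)
  case base
  have "q 1 = 1" using a1 by simp
  then have "k = q 1" using base assms(1) by linarith
  then show ?case by auto
next
  case (step n)
  consider "k \<le> q n" | "q n < k" "k < q (Suc n)" | "k = q (Suc n)" using step.prems by linarith
  then show ?case
  proof cases
    case 1
    then show ?thesis using step.IH by (auto simp: less_Suc_eq)
  next
    case 2
    then show ?thesis using step.hyps by blast
  next
    case 3
    then show ?thesis by auto
  qed
qed

lemma level_less:
  assumes "g \<in> W" "h \<in> W" "\<And>j. j < i \<Longrightarrow> g j = 0" "\<And>j. j < i \<Longrightarrow> h j = 0" "g i < h i"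
    "2 \<le> i \<or> g 2 = 0"
  shows "pt (suc_word g) < pt (suc_word h)"
  using suc_word_compare[OF assms(1,2) _ assms(5,6)] assms(3,4) parity_zero[of i h] by simp

text \<open>Condition (iii) moves the base point along the orbit, so the induction covers all words
  \<open>k\<close> that vanish below \<open>N\<close> and have digits strictly below their maxima.
  Numbers less than \<open>q N\<close> are added to such words digitwise, without carries.\<close>

lemma theta_rec_pt:
  assumes uni: "unimodal f" and f: "\<And>g. g \<in> W \<Longrightarrow> f (pt g) = pt (suc_word g)"
    and k: "k \<in> FW" "\<And>j. j < N \<Longrightarrow> k j = 0" "\<And>j. 1 \<le> j \<Longrightarrow> k j < a (Suc j)"
  shows "theta_rec a f N (pt k)"
  using k
proof (induction N arbitrary: k)
  case (Suc n)
  let ?N = "Suc n"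
  note kFW = Suc.prems(1) and kz = Suc.prems(2) and ks = Suc.prems(3)
  obtain M where M: "\<forall>n\<ge>M. k n = 0" using kFW by (auto simp: FW_iff)
  have k0: "k 0 = 0" using kFW W_0 by (auto simp: FW_iff)
  \<comment> \<open>This supplies the side condition of \<open>level_less\<close> at level
    \<open>1\<close>.\<close>
  have k2: "k 2 = 0" using ks[of 2] a3 by (simp add: numeral_2_eq_2 numeral_3_eq_3)
  define u where "u m = (suc_word ^^ m) k" for m
  have u: "u m \<in> FW" "val (u m) = val k + m" for m
    using suc_word_pow_FW[OF kFW, of m] by (auto simp: u_def)
  have uW: "u m \<in> W" for m using u(1) by (simp add: FW_iff)
  have u_eq: "u m = h" if "h \<in> W" "h = (\<lambda>j. k j + g j)" "val g = m" "\<forall>n\<ge>L. g n = 0" for m h g L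
  proof (rule val_inj[OF u(1)])
    have "\<forall>n\<ge>max M L. h n = 0" using that M by auto
    then show "h \<in> FW" using that(1) unfolding FW_iff by blast
    show "val (u m) = val h" using val_add[OF M that(4)] that(2,3) u(2) by simp
  qed
  have fu: "(f ^^ m) (pt k) = pt (u m)" for m
    by (induction m) (use f uW in \<open>auto simp: u_def\<close>)
  define L where "L m = pt (suc_word (u m))" for m
  have fL: "f ((f ^^ m) (pt k)) = L m" for m using fu f uW by (simp add: L_def)
  have u_q: "u (q i) = (\<lambda>j. k j + (if j = i then 1 else 0))" if "1 \<le> i" "i \<le> ?N" for i
  proof (rule u_eq[OF _ refl])
    show "(\<lambda>j. k j + (if j = i then 1 else 0)) \<in> W"
      unfolding W_iff
    proof (intro conjI allI impI)
      show "k j + (if j = i then 1 else 0) \<le> a (Suc j)" for j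
        using ks[of j] k0 that by (cases "j = 0") auto
      fix j assume *: "k (Suc j) + (if Suc j = i then 1 else 0) = a (Suc (Suc j))"
      then have "Suc j = i" using ks[of "Suc j"] by (auto split: if_splits)
      then show "k j + (if j = i then 1 else 0) = 0" using kz that by auto
    qed (use k0 that in auto)
    show "val (\<lambda>j. if j = i then 1 else 0) = q i" using val_single[of i 1] by simp
    show "\<forall>n\<ge>Suc i. (if n = i then 1 else 0) = 0" by auto
  qed
  have u_small: "u m = (\<lambda>j. k j + word m j)" "word m j = 0 \<or> j < ?N" if "m < q ?N" for m j
  proof -
    have wz: "word m j = 0" if "?N \<le> j" for j
      using val_ge[OF word_FW, of m j] val_word[of m] q_le[OF that] \<open>m < q ?N\<close> by linarith
    then show "word m j = 0 \<or> j < ?N" by (meson not_le)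
    have w: "word m \<in> W" using word_FW by (auto simp: FW_iff)
    show "u m = (\<lambda>j. k j + word m j)"
    proof (rule u_eq[OF _ refl val_word])
      show "\<forall>j\<ge>?N. word m j = 0" using wz by blast
      show "(\<lambda>j. k j + word m j) \<in> W"
        unfolding W_iff
      proof (intro conjI allI impI)
        show "k 0 + word m 0 = 0" using k0 W_0[OF w] by simp
        show "k j + word m j \<le> a (Suc j)" for j
          using kz[of j] wz[of j] W_le[OF w, of j] ks[of j] by (cases "j < ?N") auto
        fix j assume *: "k (Suc j) + word m (Suc j) = a (Suc (Suc j))"
        \<comment> \<open>Only \<open>word m\<close> can make the sum maximal, since the digits of
          \<open>k\<close> are strictly below their maxima; from \<open>N\<close> on
          \<open>word m\<close> vanishes.\<close>
        then have "Suc j < ?N" using ks[of "Suc j"] wz[of "Suc j"] by (cases "Suc j < ?N") auto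
        then show "k j + word m j = 0" using * kz[of "Suc j"] kz[of j] W_prev[OF w, of j] by simp
      qed
    qed
  qed
  have L0: "L 0 < L m" if m: "1 \<le> m" "m \<le> q ?N" for m
  proof (cases "m = q ?N")
    case True
    show ?thesis
      unfolding L_def
      by (rule level_less[OF uW uW, of ?N])
        (use k2 kz in \<open>auto simp: u_q[of ?N, folded True] u_def[of 0] simp del: cf_den.simps\<close>)
  next
    case False
    then have lt: "m < q ?N" using m by simp
    obtain l where l: "\<And>j. j < l \<Longrightarrow> word m j = 0" "word m l \<noteq> 0" "1 \<le> l"
      using word_leading[of m] m by auto
    have "l < ?N" using u_small(2)[OF lt, of l] l(2) by simp
    then show ?thesis
      unfolding L_def using l k2 kz
      by (intro level_less[OF uW uW, of l]) (auto simp: u_small(1)[OF lt] u_def[of 0])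
  qed
  have B: "L (q (Suc i)) < L (q i)" if i: "1 \<le> i" "i < ?N" for i
  proof -
    have u1: "u (q (Suc i)) = (\<lambda>j. k j + (if j = Suc i then 1 else 0))"
      and u2: "u (q i) = (\<lambda>j. k j + (if j = i then 1 else 0))"
      using u_q[of i] u_q[of "Suc i"] i by auto
    show ?thesis
    proof (cases "i = 1")
      case False
      then show ?thesis
        unfolding L_def using i kz u1 u2
        by (intro level_less[OF uW uW, of i]) (auto simp del: cf_den.simps)
    next
      case True
      \<comment> \<open>The comparison of leading digits fails between \<open>q 1\<close> and
        \<open>q 2\<close>. But these are \<open>1\<close> and \<open>2\<close>, so the claim
        compares the point of \<open>u 2\<close> with its own image, whose word vanishes below
        position \<open>3\<close>.\<close>
      have q12: "q i = 1" "q (Suc i) = 2" using True a1 a2 by auto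
      have e: "u 2 = suc_word (u 1)" by (simp add: u_def numeral_2_eq_2)
      have u2d: "u 2 0 = 0" "u 2 1 = 0" "u 2 2 = 1"
        using u1 True q12 k0 k2 kz[of 1] i by (auto simp: numeral_2_eq_2)
      then have "carry (u 2) 3" by (simp add: numeral_3_eq_3 numeral_2_eq_2 a3)
      then have z: "suc_word (u 2) j = 0" if "j < 3" for j using that by (rule suc_word_below)
      have "0 < esign (u 2) 2 * (pt (u 2) - pt (suc_word (u 2)))"
        using uW suc_word_W z u2d by (intro pt_compare) (auto simp: less_2_cases_iff)
      moreover have "esign (u 2) 2 = 1"
        using psign_zero[of 2 "u 2"] u2d by (auto simp: esign_def side_def less_2_cases_iff numeral_2_eq_2)
      ultimately show ?thesis using e by (simp add: L_def q12)
    qed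
  qed
  have C: "L (q i) < L m" if i: "1 \<le> i" "i < ?N" and m: "q i < m" "m < q (Suc i)" for i m
  proof -
    have lt: "m < q ?N" using m(2) q_le[of "Suc i" ?N] i by simp
    have u2: "u (q i) = (\<lambda>j. k j + (if j = i then 1 else 0))" using u_q[of i] i by auto
    \<comment> \<open>No integer lies strictly between consecutive terms of \<open>q 1 = 1\<close>,
      \<open>q 2 = 2\<close>, \<open>q 3 = 3\<close>.\<close>
    have "i \<noteq> 1" "i \<noteq> 2" using m a1 a2 a3 by (auto simp: numeral_2_eq_2)
    then have i3: "3 \<le> i" using i by simp
    obtain l where l: "\<And>j. j < l \<Longrightarrow> word m j = 0" "word m l \<noteq> 0" "1 \<le> l" "q l \<le> m"
      using word_leading[of m] m by auto
    have wz: "word m j = 0" if "i < j" for j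
      using val_ge[OF word_FW, of m j] val_word[of m] q_le[of "Suc i" j] m that by (cases "word m j = 0") auto
    have "l \<le> i" using wz[of l] l(2) by (cases "i < l") auto
    have "u (q i) l < u m l"
    proof (cases "l = i")
      case True
      \<comment> \<open>Supported at \<open>i\<close> alone, \<open>m\<close> is a multiple of
        \<open>q i\<close> larger than \<open>q i\<close>, so its digit there is at least
        \<open>2\<close>.\<close>
      have "word m = (\<lambda>j. if j = i then word m i else 0)"
        using l(1) wz True by (auto simp: fun_eq_iff) (metis linorder_neqE_nat)
      then have "m = word m i * q i" using val_single[of i "word m i"] val_word[of m] by simp
      then have "word m i \<noteq> 1" using m(1) by (metis less_irrefl mult_1)
      moreover have "word m i \<noteq> 0" using l(2) True by simp
      ultimately have "1 < word m i" by simp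
      then show ?thesis using True u_small(1)[OF lt] u2 by simp
    next
      case False
      then show ?thesis using u_small(1)[OF lt] u2 l(2) by simp
    qed
    then show ?thesis
      unfolding L_def using l(1) \<open>l \<le> i\<close> i i3 kz k2 u_small(1)[OF lt] u2
      by (intro level_less[OF uW uW, of l]) auto
  qed
  have rec: "L (q i) < L j" if "1 \<le> i" "i \<le> ?N" "0 < j" "j < q i" for i j
    using that
  proof (induction i arbitrary: j rule: dec_induct)
    case base
    then show ?case using a1 by simp
  next
    case (step i)
    then have b: "L (q (Suc i)) < L (q i)" using B by simp
    consider "j < q i" | "j = q i" | "q i < j" by linarith
    then show ?case
    proof cases
      case 1
      then show ?thesis using step.IH[of j] step.prems b by simp
    next
      case 2
      then show ?thesis using b by simp
    next
      case 3
      then show ?thesis using C[of i j] step b by simp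
    qed
  qed
  have closest: "closest_time f (pt k) m \<longleftrightarrow> 1 \<le> m \<and> (\<forall>j. 0 < j \<and> j < m \<longrightarrow> L m < L j)" for m
    by (simp add: closest_time_def fL)
  have "{m \<in> {1..q ?N}. closest_time f (pt k) m} = q ` {1..?N}"
  proof (intro equalityI subsetI)
    fix m assume "m \<in> {m \<in> {1..q ?N}. closest_time f (pt k) m}"
    then have m: "1 \<le> m" "m \<le> q ?N" and cl: "\<And>j. 0 < j \<Longrightarrow> j < m \<Longrightarrow> L m < L j"
      by (auto simp: closest)
    show "m \<in> q ` {1..?N}"
    proof (rule ccontr)
      assume "m \<notin> q ` {1..?N}"
      then obtain i where "1 \<le> i" "i < ?N" "q i < m" "m < q (Suc i)"
        using q_bracket[OF m] by auto
      then show False using C[of i m] cl[of "q i"] q_pos[of i] by simp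
    qed
  next
    fix m assume "m \<in> q ` {1..?N}"
    then obtain i where i: "1 \<le> i" "i \<le> ?N" "m = q i" by auto
    then show "m \<in> {m \<in> {1..q ?N}. closest_time f (pt k) m}"
      using rec[of i] q_le[of i ?N] q_pos[of i] by (simp add: closest)
  qed
  moreover have "(f ^^ m) (pt k) \<notin> Ix f (pt k)" if "m \<in> {1..q ?N}" for m
  proof -
    have "f (pt k) < f ((f ^^ m) (pt k))" using L0[of m] fL[of 0] fL[of m] that by simp
    moreover have "-1 < pt k" "pt k < 1" using pt_abs_less_1[of k] kFW by (auto simp: FW_iff)
    ultimately show ?thesis using unimodal_not_in_Ix[OF uni] by blast
  qed
  moreover have "theta_rec a f n ((f ^^ (m * q n)) (pt k))" if n: "1 \<le> n" and m: "m < a ?N" for m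
  proof -
    \<comment> \<open>Shifting by \<open>m * q n\<close> merely writes \<open>m\<close> into the
      empty position \<open>n\<close>, which gives a word covered by the induction
      hypothesis.\<close>
    define h where "h = (\<lambda>j. k j + (if j = n then m else 0))"
    have hs: "h j < a (Suc j)" if "1 \<le> j" for j using ks[OF that] kz[of n] m by (auto simp: h_def)
    have "h \<in> W" by (rule small_W) (use k0 n hs in \<open>auto simp: h_def\<close>)
    then have "u (m * q n) = h"
      by (rule u_eq[where L = "Suc n"]) (auto simp: h_def val_single)
    moreover have "theta_rec a f n (pt h)"
      using hs kz u(1)[of "m * q n"] calculation by (intro Suc.IH) (auto simp: h_def)
    ultimately show ?thesis using fu by simp
  qed
  ultimately show ?case by (simp del: cf_den.simps)
qed simp

section \<open>The critical orbit and its closure\<close>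

lemma pt_FW:
  assumes f: "\<And>g. g \<in> W \<Longrightarrow> f (pt g) = pt (suc_word g)" and g: "g \<in> FW"
  shows "pt g = (f ^^ val g) 0"
proof -
  have "pt (word m) = (f ^^ m) 0" for m
  proof (induction m)
    case 0
    then show ?case by (simp add: word_def pt_zero)
  next
    case (Suc m)
    have "word m \<in> W" using word_FW by (auto simp: FW_iff)
    then show ?case using f[of "word m"] Suc by (simp add: word_def)
  qed
  moreover have "g = word (val g)" by (rule val_inj[OF g word_FW]) (simp add: val_word)
  ultimately show ?thesis by metis
qed

text \<open>The compact image contains the orbit, whose points come from finite words; truncating an
  arbitrary word gives density.\<close>

lemma pt_image_eq:
  assumes f: "\<And>g. g \<in> W \<Longrightarrow> f (pt g) = pt (suc_word g)"
  shows "pt ` W = closure (range (\<lambda>m. (f ^^ m) 0))"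
proof
  have "closed (pt ` W)"
    by (intro compact_imp_closed compact_continuous_image continuous_on_pt compact_W)
  moreover have "(f ^^ m) 0 \<in> pt ` W" for m
    using pt_FW[OF f word_FW[of m]] word_FW[of m] by (metis FW_iff imageI val_word)
  ultimately show "closure (range (\<lambda>m. (f ^^ m) 0)) \<subseteq> pt ` W"
    by (intro closure_minimal) auto
  show "pt ` W \<subseteq> closure (range (\<lambda>m. (f ^^ m) 0))"
  proof
    fix x assume "x \<in> pt ` W"
    then obtain g where g: "g \<in> W" "x = pt g" by auto
    show "x \<in> closure (range (\<lambda>m. (f ^^ m) 0))"
      unfolding closure_approachable
    proof (intro allI impI)
      fix e :: real assume "0 < e"
      then obtain i where i: "weight i < e" using weight_less by blast
      define h where "h j = (if j \<le> i then g j else 0)" for j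
      have hW: "h \<in> W" using g by (auto simp: W_iff h_def)
      moreover have "\<forall>j\<ge>Suc i. h j = 0" by (simp add: h_def)
      ultimately have "h \<in> FW" unfolding FW_iff by blast
      then have "pt h = (f ^^ val h) 0" using pt_FW[OF f] by blast
      moreover have "\<bar>pt h - pt g\<bar> \<le> weight i" by (rule pt_close[OF hW g(1)]) (simp add: h_def)
      ultimately have "dist ((f ^^ val h) 0) x < e" using i g by (simp add: dist_real_def)
      then show "\<exists>y\<in>range (\<lambda>m. (f ^^ m) 0). dist y x < e" by blast
    qed
  qed
qed

end

theorem theorem2p7:
  fixes a :: "nat \<Rightarrow> nat"
  assumes irrational: "\<forall>n\<ge>1. a n \<ge> 1"
    and a123: "a 1 = 1" "a 2 = 1" "a 3 = 1"
  shows "\<exists>f. unimodal f \<and> theta_recurrent a f \<and>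
    (\<exists>(X :: (nat \<Rightarrow> nat) \<Rightarrow> real) (S :: (nat \<Rightarrow> nat) \<Rightarrow> (nat \<Rightarrow> nat)).
       (\<forall>g\<in>finite_ostrowski_words a. X g = (f ^^ ostrowski_val a g) 0)
     \<and> (\<exists>Y. homeomorphism (ostrowski_words a) (closure (range (\<lambda>k. (f ^^ k) 0))) X Y)
     \<and> continuous_on (ostrowski_words a) S
     \<and> S ` ostrowski_words a \<subseteq> ostrowski_words a
     \<and> (\<forall>g\<in>finite_ostrowski_words a. S g \<in> finite_ostrowski_words a
          \<and> ostrowski_val a (S g) = ostrowski_val a g + 1)
     \<and> (\<forall>g\<in>ostrowski_words a. X (S g) = f (X g)))"
proof -
  interpret ostrowski a
    using assms by unfold_locales (auto simp: numeral_2_eq_2 numeral_3_eq_3)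
  obtain f where f: "unimodal f" "\<And>g. g \<in> W \<Longrightarrow> f (pt g) = pt (suc_word g)"
    using unimodal_exists by blast
  \<comment> \<open>The turning point is the point of the zero word, which meets the digit
    conditions at every level.\<close>
  have "theta_rec a f n (pt (\<lambda>_. 0))" for n
    by (rule theta_rec_pt[OF f]) (auto simp: FW_iff zero_W)
  then have "theta_recurrent a f" by (simp add: theta_recurrent_def pt_zero)
  moreover have "\<exists>Y. homeomorphism W (closure (range (\<lambda>k. (f ^^ k) 0))) pt Y"
    by (rule homeomorphism_compact[OF compact_W continuous_on_pt pt_image_eq[OF f(2)] pt_inj])
  ultimately show ?thesis
    using f pt_FW[OF f(2)] continuous_on_suc_word suc_word_W suc_word_FW
    by (intro exI[of _ f] exI[of _ pt] exI[of _ suc_word] conjI ballI) auto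
qed

end
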